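(* Let $G=(V,E)$ be an $n$-vertex $m$-edge Helly graph, $A\subseteq V$ a vertex subset and $k$ a positive integer. Then the set $B_k=\{b\in V : A\subseteq N^k[b]\}$ can be computed in $\mathcal O(km)$ time.
   Context: Graphs are finite, connected, undirected and unweighted, with shortest-path distance $dist$. $N^k[b]=\{u : dist(u,b)\le k\}$ is the ball of radius $k$ centered at $b$. A graph is Helly if every family of pairwise intersecting balls has a nonempty common intersection. The problem of computing $B_k$ from $(G,A,k)$ is called Small Eccentricities. *)

theory Defs
  imports "Graph_Theory.Graph_Theory"
begin

section \<open>Balls and Helly graphs\<close>

text \<open>
  A finite simple undirected graph is a \<^locale>\<open>pair_graph\<close>, i.e. every edge is represented by its
  two opposite arcs.
\<close>

definition edges :: "'a pair_pre_digraph \<Rightarrow> 'a set set" where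
  "edges G = (\<lambda>(u, v). {u, v}) ` parcs G"

definition gdist :: "'a pair_pre_digraph \<Rightarrow> 'a \<Rightarrow> 'a \<Rightarrow> ereal" where
  "gdist G u v = wf_digraph.\<mu> (with_proj G) (\<lambda>_. 1) u v"

definition nball :: "'a pair_pre_digraph \<Rightarrow> nat \<Rightarrow> 'a \<Rightarrow> 'a set" where
  "nball G k b = {u \<in> pverts G. gdist G u b \<le> ereal (real k)}"

definition helly_graph :: "'a pair_pre_digraph \<Rightarrow> bool" where
  "helly_graph G \<longleftrightarrow>
     pair_graph G \<and> Digraph_Component.connected (with_proj G) \<and>
     (\<forall>F. F \<subseteq> {nball G r v | r v. v \<in> pverts G} \<longrightarrow>
          (\<forall>X \<in> F. \<forall>Y \<in> F. X \<inter> Y \<noteq> {}) \<longrightarrow> \<Inter>F \<noteq> {})"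

definition small_ecc :: "'a pair_pre_digraph \<Rightarrow> 'a set \<Rightarrow> nat \<Rightarrow> 'a set" where
  "small_ecc G A k = {b \<in> pverts G. A \<subseteq> nball G k b}"

section \<open>A word RAM\<close>

text \<open>
  Programs are structured programs over natural-number registers and arrays with random access;
  a program mentions only finitely many of them. Arithmetic is addition and truncated subtraction.
  Each operation (constant, register or array access, arithmetic operation, comparison, connective,
  assignment, test) costs one time unit. All numbers, including array indices, have to fit into one
  machine word, i.e. be smaller than a bound \<open>W\<close>; a program gets stuck on overflow.
\<close>

type_synonym name = string

record state =
  reg :: "name \<Rightarrow> nat"
  mem :: "name \<Rightarrow> nat \<Rightarrow> nat"

datatype aexp = Const nat | Reg name | Read name aexp | Add aexp aexp | Sub aexp aexp

datatype bexp = Less aexp aexp | Eq aexp aexp | Not bexp | And bexp bexp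

datatype com =
    Skip
  | Assign name aexp
  | Store name aexp aexp
  | Seq com com
  | If bexp com com
  | While bexp com

primrec aval :: "aexp \<Rightarrow> state \<Rightarrow> nat" where
  "aval (Const c) s = c"
| "aval (Reg x) s = reg s x"
| "aval (Read a i) s = mem s a (aval i s)"
| "aval (Add e f) s = aval e s + aval f s"
| "aval (Sub e f) s = aval e s - aval f s"

primrec afits :: "nat \<Rightarrow> aexp \<Rightarrow> state \<Rightarrow> bool" where
  "afits W (Const c) s \<longleftrightarrow> c < W"
| "afits W (Reg x) s \<longleftrightarrow> reg s x < W"
| "afits W (Read a i) s \<longleftrightarrow> afits W i s \<and> mem s a (aval i s) < W"
| "afits W (Add e f) s \<longleftrightarrow> afits W e s \<and> afits W f s \<and> aval e s + aval f s < W"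
| "afits W (Sub e f) s \<longleftrightarrow> afits W e s \<and> afits W f s"

primrec acost :: "aexp \<Rightarrow> nat" where
  "acost (Const c) = 1"
| "acost (Reg x) = 1"
| "acost (Read a i) = 1 + acost i"
| "acost (Add e f) = 1 + acost e + acost f"
| "acost (Sub e f) = 1 + acost e + acost f"

primrec bval :: "bexp \<Rightarrow> state \<Rightarrow> bool" where
  "bval (Less e f) s \<longleftrightarrow> aval e s < aval f s"
| "bval (Eq e f) s \<longleftrightarrow> aval e s = aval f s"
| "bval (Not b) s \<longleftrightarrow> \<not> bval b s"
| "bval (And b c) s \<longleftrightarrow> bval b s \<and> bval c s"

primrec bfits :: "nat \<Rightarrow> bexp \<Rightarrow> state \<Rightarrow> bool" where
  "bfits W (Less e f) s \<longleftrightarrow> afits W e s \<and> afits W f s"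
| "bfits W (Eq e f) s \<longleftrightarrow> afits W e s \<and> afits W f s"
| "bfits W (Not b) s \<longleftrightarrow> bfits W b s"
| "bfits W (And b c) s \<longleftrightarrow> bfits W b s \<and> bfits W c s"

primrec bcost :: "bexp \<Rightarrow> nat" where
  "bcost (Less e f) = 1 + acost e + acost f"
| "bcost (Eq e f) = 1 + acost e + acost f"
| "bcost (Not b) = 1 + bcost b"
| "bcost (And b c) = 1 + bcost b + bcost c"

text \<open>\<open>exec W P s t s'\<close>: started in \<open>s\<close>, \<open>P\<close> halts in \<open>s'\<close> after exactly \<open>t\<close> time units.\<close>

inductive exec :: "nat \<Rightarrow> com \<Rightarrow> state \<Rightarrow> nat \<Rightarrow> state \<Rightarrow> bool" for W :: nat where
  exec_Skip: "exec W Skip s 1 s"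
| exec_Assign:
    "afits W e s \<Longrightarrow>
     exec W (Assign x e) s (1 + acost e) (s\<lparr>reg := (reg s)(x := aval e s)\<rparr>)"
| exec_Store:
    "afits W i s \<Longrightarrow> afits W e s \<Longrightarrow>
     exec W (Store a i e) s (1 + acost i + acost e)
       (s\<lparr>mem := (mem s)(a := (mem s a)(aval i s := aval e s))\<rparr>)"
| exec_Seq:
    "exec W p s t1 s1 \<Longrightarrow> exec W q s1 t2 s2 \<Longrightarrow> exec W (Seq p q) s (t1 + t2) s2"
| exec_IfTrue:
    "bfits W b s \<Longrightarrow> bval b s \<Longrightarrow> exec W p s t s1 \<Longrightarrow> exec W (If b p q) s (1 + bcost b + t) s1"
| exec_IfFalse:
    "bfits W b s \<Longrightarrow> \<not> bval b s \<Longrightarrow> exec W q s t s1 \<Longrightarrow> exec W (If b p q) s (1 + bcost b + t) s1"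
| exec_WhileFalse:
    "bfits W b s \<Longrightarrow> \<not> bval b s \<Longrightarrow> exec W (While b p) s (1 + bcost b) s"
| exec_WhileTrue:
    "bfits W b s \<Longrightarrow> bval b s \<Longrightarrow> exec W p s t1 s1 \<Longrightarrow> exec W (While b p) s1 t2 s2 \<Longrightarrow>
     exec W (While b p) s (1 + bcost b + t1 + t2) s2"

inductive_cases exec_SkipE: "exec W Skip s t s'"
inductive_cases exec_AssignE: "exec W (Assign x e) s t s'"
inductive_cases exec_StoreE: "exec W (Store a i e) s t s'"
inductive_cases exec_SeqE: "exec W (Seq p q) s t s'"
inductive_cases exec_IfE: "exec W (If b p q) s t s'"
inductive_cases exec_WhileE: "exec W (While b p) s t s'"

lemma exec_deterministic:
  "exec W p s t s1 \<Longrightarrow> exec W p s t' s1' \<Longrightarrow> t = t' \<and> s1 = s1'"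
proof (induction arbitrary: t' s1' rule: exec.induct)
  case (exec_Seq p s t1 s1 q t2 s2)
  from exec_Seq.prems obtain u1 u2 r where
    "exec W p s u1 r" "exec W q r u2 s1'" "t' = u1 + u2"
    by (rule exec_SeqE) blast
  with exec_Seq.IH show ?case by blast
next
  case (exec_IfTrue b s p t s1 q)
  from exec_IfTrue.prems obtain u where "exec W p s u s1'" "t' = 1 + bcost b + u"
    by (rule exec_IfE) (use exec_IfTrue.hyps in auto)
  with exec_IfTrue.IH show ?case by blast
next
  case (exec_IfFalse b s q t s1 p)
  from exec_IfFalse.prems obtain u where "exec W q s u s1'" "t' = 1 + bcost b + u"
    by (rule exec_IfE) (use exec_IfFalse.hyps in auto)
  with exec_IfFalse.IH show ?case by blast
next
  case (exec_WhileFalse b s p)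
  from exec_WhileFalse.prems show ?case
    by (rule exec_WhileE) (use exec_WhileFalse.hyps in auto)
next
  case (exec_WhileTrue b s p t1 s1 t2 s2)
  from exec_WhileTrue.prems obtain u1 u2 r where
    "exec W p s u1 r" "exec W (While b p) r u2 s1'" "t' = 1 + bcost b + u1 + u2"
    by (rule exec_WhileE) (use exec_WhileTrue.hyps in auto)
  with exec_WhileTrue.IH show ?case by blast
qed (erule exec_SkipE exec_AssignE exec_StoreE, simp)+

section \<open>Input and output of the problem Small Eccentricities\<close>

text \<open>
  An adjacency-list representation of \<open>G\<close>: \<open>vs\<close> numbers the vertices (in an arbitrary way), and
  \<open>ns ! i\<close> lists (in an arbitrary order) the numbers of the neighbours of the vertex number \<open>i\<close>.
\<close>

definition adj_lists :: "'a pair_pre_digraph \<Rightarrow> 'a list \<Rightarrow> nat list list \<Rightarrow> bool" where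
  "adj_lists G vs ns \<longleftrightarrow>
     distinct vs \<and> set vs = pverts G \<and> length ns = length vs \<and>
     (\<forall>i < length vs. distinct (ns ! i) \<and>
        set (ns ! i) = {j. j < length vs \<and> (vs ! i, vs ! j) \<in> parcs G})"

text \<open>
  The adjacency lists are stored one after the other in the array \<open>adj\<close>; the list of vertex \<open>i\<close>
  occupies the cells \<open>off[i], \<dots>, off[i + 1] - 1\<close>. The set \<open>A\<close> is given by its characteristic vector.
\<close>

definition input_state :: "'a list \<Rightarrow> nat list list \<Rightarrow> 'a set \<Rightarrow> nat \<Rightarrow> state" where
  "input_state vs ns A k =
     \<lparr>reg = (\<lambda>_. 0)(''n'' := length vs, ''k'' := k),
      mem = (\<lambda>_ _. 0)
        (''off'' := (\<lambda>i. if i \<le> length vs then length (concat (take i ns)) else 0),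
         ''adj'' := (\<lambda>j. if j < length (concat ns) then concat ns ! j else 0),
         ''A'' := (\<lambda>i. if i < length vs \<and> vs ! i \<in> A then 1 else 0))\<rparr>"

definition outputs_set :: "'a list \<Rightarrow> state \<Rightarrow> 'a set \<Rightarrow> bool" where
  "outputs_set vs s B \<longleftrightarrow>
     (\<forall>i < length vs. mem s ''out'' i = (if vs ! i \<in> B then 1 else 0))"

end

theory Submission
  imports Defs
begin

text \<open>
  For a part \<open>A\<^sub>j\<close> of \<open>A\<close> let \<open>B\<^sub>i(A\<^sub>j)\<close> be the set of all vertices at distance at most \<open>i\<close> from
  every vertex of \<open>A\<^sub>j\<close>. If \<open>B\<^sub>i(A\<^sub>j)\<close> is nonempty, then the Helly property, applied to the unit ball
  around a vertex of \<open>B\<^sub>i\<^sub>+\<^sub>1(A\<^sub>j)\<close> and to the balls of radius \<open>i\<close> around the vertices of \<open>A\<^sub>j\<close>, yields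
  \<open>B\<^sub>i\<^sub>+\<^sub>1(A\<^sub>j) = N[B\<^sub>i(A\<^sub>j)]\<close>.

  Starting from the partition of \<open>A\<close> into singletons, one keeps a partition whose sets \<open>B\<^sub>i(A\<^sub>j)\<close> are
  nonempty and pairwise disjoint; they are represented by a vertex labelling. In a round all these
  sets are expanded to their closed neighbourhoods, in time \<open>O(n + m)\<close> by disjointness. Disjointness
  is restored by inserting the expanded sets one by one: a set \<open>S\<close> meeting a set \<open>T\<close> that is already
  present is merged with it, which replaces \<open>T\<close> by \<open>S \<inter> T\<close>. After \<open>k\<close> rounds, \<open>B\<^sub>k(A)\<close> is the
  intersection of the remaining disjoint sets: the only one of them, or empty if there are several.
\<close>

section \<open>Balls in Helly graphs\<close>

lemma card_doubleton_fibre: "finite {(x, y). {x, y} = {a,b}} \<and> card {(x, y). {x, y} = {a,b}} \<le> 2"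
proof -
    have sub: "{(x, y). {x, y} = {a,b}} \<subseteq> {(a, b), (b, a)}"
      by (clarsimp simp only: doubleton_eq_iff)
    have "card {(x, y). {x, y} = {a,b}} \<le> card {(a, b), (b, a)}"
      by (rule card_mono[OF _ sub]) simp
    also have "\<dots> \<le> 2" by (rule card_insert_le_m1) simp_all
    finally show ?thesis using finite_subset[OF sub] by simp
qed

context pair_graph
begin

lemma mem_nball_iff_awalk:
  "u \<in> nball G k b \<longleftrightarrow> (\<exists>p. awalk u p b \<and> length p \<le> k)"
proof -
  have cost: "awalk_cost (\<lambda>_. 1) p = real (length p)" for p :: "('a \<times> 'a) list"
    by (induct p) auto
  have "gdist G u b \<le> ereal (real k) \<longleftrightarrow> (\<exists>p. awalk u p b \<and> length p \<le> k)"
  proof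
    assume "gdist G u b \<le> ereal (real k)"
    \<comment> \<open>The bound is made strict because only an infimum strictly below a value yields
      a witness; the walk found is shorter than \<open>k + 1\<close>, hence of length at most
      \<open>k\<close>.\<close>
    also have "ereal (real k) < ereal (real (Suc k))" by simp
    finally have "(INF p\<in>{p. awalk u p b}. ereal (awalk_cost (\<lambda>_. 1) p)) < ereal (real (Suc k))"
      unfolding gdist_def \<mu>_def .
    then obtain p where "awalk u p b" "ereal (real (length p)) < ereal (real (Suc k))"
      unfolding INF_less_iff cost by blast
    then show "\<exists>p. awalk u p b \<and> length p \<le> k"
      by (intro exI[of _ p]) auto
  next
    assume "\<exists>p. awalk u p b \<and> length p \<le> k"
    then obtain p where p: "awalk u p b" "length p \<le> k" by blast
    have "gdist G u b \<le> ereal (awalk_cost (\<lambda>_. 1) p)"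
      unfolding gdist_def by (rule min_cost_le_walk_cost[OF p(1)])
    also have "\<dots> \<le> ereal (real k)" using p(2) by (simp add: cost)
    finally show "gdist G u b \<le> ereal (real k)" .
  qed
  then show ?thesis
    unfolding nball_def using awalk_hd_in_verts by auto
qed

lemma mem_nballI: "awalk u p b \<Longrightarrow> length p \<le> k \<Longrightarrow> u \<in> nball G k b"
  unfolding mem_nball_iff_awalk by (intro exI conjI)

lemma mem_nballE:
  assumes "u \<in> nball G k b"
  obtains p where "awalk u p b" "length p \<le> k"
  using assms unfolding mem_nball_iff_awalk by (elim exE conjE)

lemma mem_nball_commute: "u \<in> nball G k b \<longleftrightarrow> b \<in> nball G k u"
proof -
  have sym: "b \<in> nball G k u" if "u \<in> nball G k b" for u b
  proof -
    from that obtain p where p: "awalk u p b" "length p \<le> k" by (rule mem_nballE)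
    have "length (rev_path p) = length p" by (induct p) simp_all
    then show ?thesis using p by (intro mem_nballI[of _ "rev_path p"]) simp_all
  qed
  show ?thesis by (rule iffI; erule sym)
qed

lemma nball_0: "nball G 0 b = (if b \<in> pverts G then {b} else {})"
  by (rule set_eqI) (auto simp add: mem_nball_iff_awalk awalk_Nil_iff)

lemma mem_nball_Suc:
  "u \<in> nball G (Suc k) b \<longleftrightarrow>
    (\<exists>w. (u = w \<or> (u, w) \<in> parcs G) \<and> w \<in> nball G k b)"
proof
  assume "u \<in> nball G (Suc k) b"
  then obtain p where p: "awalk u p b" "length p \<le> Suc k" by (rule mem_nballE)
  show "\<exists>w. (u = w \<or> (u, w) \<in> parcs G) \<and> w \<in> nball G k b"
  proof (cases p)
    case Nil
    then have "u \<in> nball G k b" using p by (intro mem_nballI[of _ p]) simp_all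
    then show ?thesis by blast
  next
    case (Cons e es)
    then have "e \<in> parcs G" "u = fst e" "awalk (snd e) es b" "length es \<le> k"
      using p by (simp_all add: awalk_Cons_iff)
    then have "(u, snd e) \<in> parcs G" "snd e \<in> nball G k b"
      by (simp, intro mem_nballI)
    then show ?thesis by blast
  qed
next
  assume "\<exists>w. (u = w \<or> (u, w) \<in> parcs G) \<and> w \<in> nball G k b"
  then obtain w where w: "u = w \<or> (u, w) \<in> parcs G" "w \<in> nball G k b" by blast
  obtain p where p: "awalk w p b" "length p \<le> k" by (rule mem_nballE[OF w(2)])
  from w(1) show "u \<in> nball G (Suc k) b"
  proof
    assume "u = w"
    then show ?thesis using p by (intro mem_nballI[of _ p]) simp_all
  next
    assume "(u, w) \<in> parcs G"
    then show ?thesis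
      using p by (intro mem_nballI[of _ "(u, w) # p"]) (simp_all add: awalk_Cons_iff)
  qed
qed

lemma nball_subset_verts: "nball G k b \<subseteq> pverts G"
  by (auto simp: nball_def)

text \<open>An edge \<open>{a, b}\<close> can only come from the arcs \<open>(a, b)\<close> and
  \<open>(b, a)\<close>, so bounds in terms of arcs become bounds in terms of
  \<open>m\<close>.\<close>

lemma card_arcs_le_edges: "card (parcs G) \<le> 2 * card (edges G)"
proof -
  have fin: "finite (edges G)" unfolding edges_def using pair_finite_arcs by (rule finite_imageI)
  have sub: "parcs G \<subseteq> (\<Union>e\<in>edges G. {(x, y). {x, y} = e})"
  proof
    fix p assume p: "p \<in> parcs G"
    have "(case p of (u, v) \<Rightarrow> {u, v}) \<in> edges G"
      unfolding edges_def using p by (rule imageI)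
    then show "p \<in> (\<Union>e\<in>edges G. {(x, y). {x, y} = e})"
      by (rule UN_I) (simp add: case_prod_beta)
  qed
  have fib: "finite {(x, y). {x, y} = e} \<and> card {(x, y). {x, y} = e} \<le> 2"
    if "e \<in> edges G" for e
  proof -
    from that obtain p where e: "e = (case p of (u, v) \<Rightarrow> {u, v})"
      unfolding edges_def by (rule imageE)
    show ?thesis unfolding e by (cases p) (simp only: prod.case card_doubleton_fibre)
  qed
  have "card (parcs G) \<le> card (\<Union>e\<in>edges G. {(x, y). {x, y} = e})"
    by (rule card_mono[OF _ sub]) (use fin fib in blast)
  also have "\<dots> \<le> (\<Sum>e\<in>edges G. card {(x, y). {x, y} = e})"
    by (rule card_UN_le[OF fin])
  also have "\<dots> \<le> (\<Sum>e\<in>edges G. 2)" by (rule sum_mono) (use fib in blast)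
  finally show ?thesis by simp
qed

text \<open>Every vertex has a walk to some other vertex and is the tail of its first arc, so the
  tails cover all vertices. This lets \<open>m\<close> absorb the \<open>n\<close> in the running
  time; it fails for a single vertex.\<close>

lemma connected_card_verts_le_arcs:
  assumes "Digraph_Component.connected (with_proj G)" and "2 \<le> card (pverts G)"
  shows "card (pverts G) \<le> card (parcs G)"
proof -
  have "u \<in> fst ` parcs G" if u: "u \<in> pverts G" for u
  proof -
    obtain v where v: "v \<in> pverts G" "v \<noteq> u"
    proof -
      have "\<not> pverts G \<subseteq> {u}"
        using assms(2) card_mono[of "{u}" "pverts G"] by auto
      then show ?thesis using that by blast
    qed
    have "u \<rightarrow>\<^sup>*\<^bsub>with_proj G\<^esub> v"
      using symmetric_connected_imp_strongly_connected[OF pair_sym_arcs assms(1)] u v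
      by (auto simp: strongly_connected_def)
    then obtain p where p: "awalk u p v" unfolding reachable_awalk by (rule exE)
    then show ?thesis using v by (cases p) (auto simp: awalk_simps)
  qed
  then have "pverts G \<subseteq> fst ` parcs G" by blast
  then show ?thesis
    using pair_finite_arcs by (meson card_image_le card_mono finite_imageI order_trans)
qed

end

text \<open>The balls around \<open>A\<close> pairwise meet in \<open>c\<close>. The unit ball
  around \<open>b\<close> meets each of them after at most one step of a shortest route from
  \<open>b\<close>. The Helly property then gives \<open>w\<close>.\<close>

lemma helly_expand_common_ball:
  assumes "helly_graph G" and "A \<subseteq> pverts G" and "b \<in> pverts G"
    and nonempty: "c \<in> pverts G" "\<And>a. a \<in> A \<Longrightarrow> c \<in> nball G i a"
    and b: "\<And>a. a \<in> A \<Longrightarrow> b \<in> nball G (Suc i) a"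
  obtains w where "w \<in> pverts G" "b = w \<or> (b, w) \<in> parcs G"
    "\<And>a. a \<in> A \<Longrightarrow> w \<in> nball G i a"
proof -
  interpret pair_graph G using assms(1) by (simp add: helly_graph_def)
  define F where "F = insert (nball G 1 b) (nball G i ` A)"
  have one: "w \<in> nball G 1 b \<longleftrightarrow> b = w \<or> (b, w) \<in> parcs G" for w
    using assms(3) arcs_symmetric by (auto simp: mem_nball_Suc nball_0)
  have "F \<subseteq> {nball G r v | r v. v \<in> pverts G}"
    using assms(2,3) by (auto simp: F_def)
  moreover have "\<forall>X\<in>F. \<forall>Y\<in>F. X \<inter> Y \<noteq> {}"
  proof -
    have 1: "b \<in> nball G 1 b" using one by blast
    have 2: "nball G 1 b \<inter> nball G i a \<noteq> {}" if "a \<in> A" for a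
      using b[OF that] one unfolding mem_nball_Suc by blast
    show ?thesis using 1 2 nonempty(2) unfolding F_def by blast
  qed
  ultimately have "\<Inter>F \<noteq> {}"
    using assms(1) unfolding helly_graph_def by blast
  then obtain w where "w \<in> nball G 1 b" "\<And>a. a \<in> A \<Longrightarrow> w \<in> nball G i a"
    unfolding F_def by auto
  moreover from this(1) have "w \<in> pverts G" using nball_subset_verts by blast
  ultimately show ?thesis using that one by blast
qed

section \<open>Labelled families of disjoint sets\<close>

text \<open>
  There is a partition of \<open>D\<close> into parts numbered by \<open>L\<close> (the fibres of \<open>g\<close>) such that the vertices
  labelled \<open>l\<close> are those near all members of part \<open>l\<close>, and every label in \<open>L\<close> occurs.
  Disjointness is implicit, as a vertex has only one label. Labels outside \<open>L\<close> are meaningless.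
\<close>

definition grouped :: "nat \<Rightarrow> ('b \<Rightarrow> nat \<Rightarrow> bool) \<Rightarrow> 'b set \<Rightarrow> (nat \<Rightarrow> nat) \<Rightarrow> nat set \<Rightarrow> bool" where
  "grouped n near D lab L \<longleftrightarrow> 0 \<notin> L \<and>
    (\<exists>g. g ` D = L \<and>
      (\<forall>l\<in>L. {v. v < n \<and> lab v = l} \<noteq> {} \<and>
        {v. v < n \<and> lab v = l} = {v. v < n \<and> (\<forall>a\<in>D. g a = l \<longrightarrow> near a v)}))"

lemma grouped_empty: "grouped n near {} lab {}"
  by (simp add: grouped_def)

lemma grouped_cong:
  assumes "\<And>v l. v < n \<Longrightarrow> l \<in> L \<Longrightarrow> lab v = l \<longleftrightarrow> lab' v = l"
  shows "grouped n near D lab L \<longleftrightarrow> grouped n near D lab' L"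
proof -
  have "{v. v < n \<and> lab v = l} = {v. v < n \<and> lab' v = l}" if "l \<in> L" for l
    using assms that by blast
  then show ?thesis unfolding grouped_def
    by (intro conj_cong refl ex_cong1 ball_cong) simp_all
qed

text \<open>\<open>E\<close> is the part to be inserted, \<open>S\<close> its set, \<open>l\<close>
  a fresh label; \<open>c\<close> is a live label met by \<open>S\<close>, or \<open>0\<close> if
  there is none. Even if \<open>S\<close> meets several sets, merging with one of them suffices: the
  intersection lies inside set \<open>c\<close>, which is disjoint from all the others.\<close>

lemma grouped_merge:
  assumes grouped: "grouped n near D own L"
    and E: "E \<noteq> {}" "D \<inter> E = {}"
    and S: "S = {u. u < n \<and> (\<forall>a\<in>E. near a u)}" "S \<noteq> {}"
    and l: "l \<noteq> 0" "l \<notin> L" "\<And>v. v < n \<Longrightarrow> own v \<noteq> l"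
    and c: "(c = 0 \<and> (\<forall>u\<in>S. own u \<notin> L)) \<or> (c \<in> L \<and> (\<exists>u\<in>S. own u = c))"
    and own': "\<And>u. u < n \<Longrightarrow> own' u = (if u \<in> S \<and> (own u = c \<or> c = 0) then l else own u)"
  shows "grouped n near (D \<union> E) own' (insert l (L - {c}))"
proof -
  from grouped obtain g where g: "g ` D = L" "0 \<notin> L"
    "\<And>l. l \<in> L \<Longrightarrow> {v. v < n \<and> own v = l} \<noteq> {}"
    "\<And>l v. l \<in> L \<Longrightarrow> v < n \<Longrightarrow> own v = l \<longleftrightarrow> (\<forall>a\<in>D. g a = l \<longrightarrow> near a v)"
    unfolding grouped_def by blast
  \<comment> \<open>Part \<open>c\<close> and \<open>E\<close> are fused under the number
    \<open>l\<close>. For \<open>c = 0\<close> no member of \<open>D\<close> changes its part, as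
    \<open>g\<close> never takes the value \<open>0\<close> on \<open>D\<close>.\<close>
  define g' where "g' a = (if a \<in> E \<or> g a = c then l else g a)" for a
  have g'D: "g' a = (if g a = c then l else g a)" if "a \<in> D" for a
    using that E(2) by (auto simp: g'_def)
  have g'E: "g' a = l" if "a \<in> E" for a using that by (simp add: g'_def)
  have "g' ` D \<union> {l} = insert l (L - {c})"
    using g(1) by (auto simp: g'D image_iff)
  then have img: "g' ` (D \<union> E) = insert l (L - {c})"
    using E(1) g'E by (auto simp: image_Un)
  \<comment> \<open>Being near the fused part means lying in \<open>S\<close> and in the old set
    \<open>c\<close>; for \<open>c = 0\<close> the second condition is vacuous.\<close>
  have new: "own' v = l \<longleftrightarrow> (\<forall>a\<in>D \<union> E. g' a = l \<longrightarrow> near a v)" if v: "v < n" for v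
  proof -
    have "(\<forall>a\<in>D \<union> E. g' a = l \<longrightarrow> near a v) \<longleftrightarrow> v \<in> S \<and> (\<forall>a\<in>D. g a = c \<longrightarrow> near a v)"
      using v S(1) g'D g'E l(2) g(1) by auto
    also have "\<dots> \<longleftrightarrow> v \<in> S \<and> (own v = c \<or> c = 0)"
    proof (cases "c = 0")
      case True
      then show ?thesis using g(1,2) by auto
    next
      case False
      then have "c \<in> L" using c by blast
      then show ?thesis using g(4) v False by auto
    qed
    also have "\<dots> \<longleftrightarrow> own' v = l" using own'[OF v] l(3)[OF v] by auto
    finally show ?thesis ..
  qed
  have new_ne: "\<exists>v<n. own' v = l"
  proof -
    obtain u where "u \<in> S" "own u = c \<or> c = 0" using c S(2) by blast
    then show ?thesis using own' S(1) by auto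
  qed
  \<comment> \<open>If \<open>c = 0\<close>, no vertex of \<open>S\<close> has a live label;
    otherwise only vertices labelled \<open>c\<close> are overwritten. Either way the other live
    sets survive.\<close>
  have old: "own' v = m \<longleftrightarrow> own v = m" if "v < n" "m \<in> L" "m \<noteq> c" for v m
    using own'[OF that(1)] c that l(2) g(2) by auto
  have old': "own v = m \<longleftrightarrow> (\<forall>a\<in>D \<union> E. g' a = m \<longrightarrow> near a v)"
    if "v < n" "m \<in> L" "m \<noteq> c" for v m
    using g(4)[OF that(2,1)] g'D g'E that l(2) by (auto split: if_splits)
  show ?thesis
    unfolding grouped_def
  proof (intro conjI exI[of _ g'] ballI)
    show "0 \<notin> insert l (L - {c})" using l(1) g(2) by auto
    show "g' ` (D \<union> E) = insert l (L - {c})" by (rule img)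
    fix m assume m: "m \<in> insert l (L - {c})"
    show "{v. v < n \<and> own' v = m} \<noteq> {}"
    proof (cases "m = l")
      case True
      then show ?thesis using new_ne by auto
    next
      case False
      then have "m \<in> L" "m \<noteq> c" using m by auto
      then show ?thesis using g(3)[of m] old by auto
    qed
    show "{v. v < n \<and> own' v = m} = {v. v < n \<and> (\<forall>a\<in>D \<union> E. g' a = m \<longrightarrow> near a v)}"
    proof (cases "m = l")
      case True
      then show ?thesis using new by blast
    next
      case False
      then have "m \<in> L" "m \<noteq> c" using m by auto
      then show ?thesis using old old' by blast
    qed
  qed
qed

abbreviation labels :: "nat \<Rightarrow> (nat \<Rightarrow> nat) \<Rightarrow> nat set" where
  "labels n lab \<equiv> lab ` {..<n} - {0}"

text \<open>Clearing dead labels makes the live ones readable off the vertices: as every set of the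
  family is nonempty, the nonzero labels that occur are exactly \<open>L\<close>.\<close>

lemma grouped_normalize:
  assumes "grouped n near D own L"
    and lab: "\<And>v. v < n \<Longrightarrow> lab v = (if own v \<in> L then own v else 0)"
  shows "grouped n near D lab (labels n lab)"
proof -
  have 0: "0 \<notin> L" and ne: "\<And>l. l \<in> L \<Longrightarrow> \<exists>v<n. own v = l"
    using assms(1) unfolding grouped_def by auto
  have "labels n lab = L"
  proof
    show "labels n lab \<subseteq> L" using lab by auto
    show "L \<subseteq> labels n lab"
    proof
      fix l assume "l \<in> L"
      then obtain v where "v < n" "own v = l" using ne by blast
      then have "lab v = l" "l \<noteq> 0" using lab[of v] \<open>l \<in> L\<close> 0 by (simp, metis)
      then show "l \<in> labels n lab" using \<open>v < n\<close> by blast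
    qed
  qed
  moreover have "grouped n near D own L \<longleftrightarrow> grouped n near D lab L"
    by (rule grouped_cong) (use lab 0 in auto)
  ultimately show ?thesis using assms(1) by simp
qed

text \<open>With \<open>near\<close> and \<open>near'\<close> for radius \<open>i\<close> and
  \<open>i + 1\<close>, this is the closed-neighbourhood formula for all parts at once. One
  inclusion is the triangle inequality \<open>near\<close>; the other is \<open>helly\<close>, whose
  vertex \<open>c\<close> exists because the sets of the family are nonempty.\<close>

lemma grouped_expand:
  assumes "grouped n near A lab L"
    and helly: "\<And>E c u. E \<subseteq> A \<Longrightarrow> c < n \<Longrightarrow> \<forall>a\<in>E. near a c \<Longrightarrow> u < n \<Longrightarrow> \<forall>a\<in>E. near' a u \<Longrightarrow>
      \<exists>w<n. u \<in> N w \<and> (\<forall>a\<in>E. near a w)"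
    and near: "\<And>a u w. a \<in> A \<Longrightarrow> w < n \<Longrightarrow> u \<in> N w \<Longrightarrow> near a w \<Longrightarrow> near' a u"
    and N: "\<And>w. w < n \<Longrightarrow> N w \<subseteq> {..<n}"
  obtains f where "f ` A = L"
    "\<And>l. l \<in> L \<Longrightarrow>
      (\<Union>v\<in>{v. v < n \<and> lab v = l}. N v) = {u. u < n \<and> (\<forall>a\<in>{a \<in> A. f a = l}. near' a u)}"
proof -
  from assms(1) obtain f where f: "f ` A = L"
    "\<And>l. l \<in> L \<Longrightarrow> {v. v < n \<and> lab v = l} \<noteq> {}"
    "\<And>l. l \<in> L \<Longrightarrow> {v. v < n \<and> lab v = l} = {v. v < n \<and> (\<forall>a\<in>A. f a = l \<longrightarrow> near a v)}"
    unfolding grouped_def by blast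
  have "(\<Union>v\<in>{v. v < n \<and> lab v = l}. N v) = {u. u < n \<and> (\<forall>a\<in>{a \<in> A. f a = l}. near' a u)}"
    if l: "l \<in> L" for l
  proof (intro equalityI subsetI)
    fix u assume "u \<in> (\<Union>v\<in>{v. v < n \<and> lab v = l}. N v)"
    then obtain v where "v < n" "\<forall>a\<in>A. f a = l \<longrightarrow> near a v" "u \<in> N v"
      using f(3)[OF l] by blast
    then show "u \<in> {u. u < n \<and> (\<forall>a\<in>{a \<in> A. f a = l}. near' a u)}"
      using near N by blast
  next
    fix u assume u: "u \<in> {u. u < n \<and> (\<forall>a\<in>{a \<in> A. f a = l}. near' a u)}"
    obtain c where "c < n" "\<forall>a\<in>{a \<in> A. f a = l}. near a c"
      using f(2,3)[OF l] by blast
    then obtain w where "w < n" "u \<in> N w" "\<forall>a\<in>{a \<in> A. f a = l}. near a w"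
      using helly[of "{a \<in> A. f a = l}" c u] u by auto
    then show "u \<in> (\<Union>v\<in>{v. v < n \<and> lab v = l}. N v)"
      using f(3)[OF l] by blast
  qed
  with f(1) show ?thesis by (rule that)
qed

text \<open>A vertex is near all of \<open>A\<close> iff it lies in every set of the family; having
  a single label, it does so iff \<open>L\<close> contains no other label. For empty
  \<open>A\<close> the set \<open>L\<close> is empty and every vertex qualifies.\<close>

lemma grouped_all_near_iff:
  assumes "grouped n near A lab L" and "v < n"
  shows "(\<forall>a\<in>A. near a v) \<longleftrightarrow> L \<subseteq> {lab v}"
proof -
  from assms(1) obtain f where f: "f ` A = L"
    "\<And>l v. l \<in> L \<Longrightarrow> v < n \<Longrightarrow> lab v = l \<longleftrightarrow> (\<forall>a\<in>A. f a = l \<longrightarrow> near a v)"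
    unfolding grouped_def by blast
  show ?thesis
  proof
    assume "\<forall>a\<in>A. near a v"
    then show "L \<subseteq> {lab v}" using f(2)[OF _ assms(2)] by blast
  next
    assume *: "L \<subseteq> {lab v}"
    show "\<forall>a\<in>A. near a v"
    proof
      fix a assume a: "a \<in> A"
      then have "f a \<in> L" using f(1) by blast
      then have "lab v = f a" using subsetD[OF *] by simp
      with f(2)[OF \<open>f a \<in> L\<close> assms(2)] a show "near a v" by blast
    qed
  qed
qed

section \<open>Weakest preconditions with time\<close>

text \<open>
  Weakest preconditions with the elapsed time \<open>\<tau>\<close> as a ghost variable, so that running times can be
  bounded in loop invariants and postconditions.
\<close>

definition wp :: "nat \<Rightarrow> com \<Rightarrow> (state \<Rightarrow> nat \<Rightarrow> bool) \<Rightarrow> state \<Rightarrow> nat \<Rightarrow> bool" where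
  "wp W p Q s \<tau> \<longleftrightarrow> (\<exists>t s'. exec W p s t s' \<and> Q s' (\<tau> + t))"

lemma wp_mono: "wp W p Q s \<tau> \<Longrightarrow> (\<And>s' \<tau>'. Q s' \<tau>' \<Longrightarrow> R s' \<tau>') \<Longrightarrow> wp W p R s \<tau>"
  unfolding wp_def by blast

lemma wp_Skip [simp]: "wp W Skip Q s \<tau> \<longleftrightarrow> Q s (\<tau> + 1)"
  unfolding wp_def by (metis exec_Skip exec_SkipE)

lemma wp_Assign [simp]: "wp W (Assign x e) Q s \<tau> \<longleftrightarrow>
    afits W e s \<and> Q (s\<lparr>reg := (reg s)(x := aval e s)\<rparr>) (\<tau> + (1 + acost e))"
  unfolding wp_def by (metis exec_Assign exec_AssignE)

lemma wp_Store [simp]: "wp W (Store a i e) Q s \<tau> \<longleftrightarrow>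
    afits W i s \<and> afits W e s \<and>
    Q (s\<lparr>mem := (mem s)(a := (mem s a)(aval i s := aval e s))\<rparr>) (\<tau> + (1 + acost i + acost e))"
  unfolding wp_def by (metis exec_Store exec_StoreE)

lemma wp_Seq [simp]: "wp W (Seq p q) Q s \<tau> \<longleftrightarrow> wp W p (wp W q Q) s \<tau>"
proof
  assume "wp W (Seq p q) Q s \<tau>"
  then show "wp W p (wp W q Q) s \<tau>"
    unfolding wp_def by (auto elim!: exec_SeqE simp: add.assoc)
next
  assume "wp W p (wp W q Q) s \<tau>"
  then obtain t1 s1 t2 s2 where "exec W p s t1 s1" "exec W q s1 t2 s2" "Q s2 (\<tau> + t1 + t2)"
    unfolding wp_def by blast
  then show "wp W (Seq p q) Q s \<tau>"
    unfolding wp_def by (metis exec_Seq add.assoc)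
qed

lemma wp_If [simp]: "wp W (If b p q) Q s \<tau> \<longleftrightarrow>
    bfits W b s \<and> (if bval b s then wp W p Q s (\<tau> + (1 + bcost b))
                   else wp W q Q s (\<tau> + (1 + bcost b)))"
proof
  assume "wp W (If b p q) Q s \<tau>"
  then show "bfits W b s \<and> (if bval b s then wp W p Q s (\<tau> + (1 + bcost b))
                   else wp W q Q s (\<tau> + (1 + bcost b)))"
    unfolding wp_def by (force elim!: exec_IfE simp: add.assoc)
next
  assume *: "bfits W b s \<and> (if bval b s then wp W p Q s (\<tau> + (1 + bcost b))
                   else wp W q Q s (\<tau> + (1 + bcost b)))"
  show "wp W (If b p q) Q s \<tau>"
  proof (cases "bval b s")
    case True
    with * obtain t s' where "exec W p s t s'" "Q s' (\<tau> + (1 + bcost b) + t)"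
      unfolding wp_def by auto
    then show ?thesis unfolding wp_def
      using exec_IfTrue[of W b s p t s' q] * True by (metis add.assoc)
  next
    case False
    with * obtain t s' where "exec W q s t s'" "Q s' (\<tau> + (1 + bcost b) + t)"
      unfolding wp_def by auto
    then show ?thesis unfolding wp_def
      using exec_IfFalse[of W b s q t s' p] * False by (metis add.assoc)
  qed
qed

lemma wp_While_iff: "wp W (While b p) Q s \<tau> \<longleftrightarrow>
    bfits W b s \<and> (if bval b s then wp W p (wp W (While b p) Q) s (\<tau> + (1 + bcost b))
                   else Q s (\<tau> + (1 + bcost b)))"
proof
  assume "wp W (While b p) Q s \<tau>"
  then show "bfits W b s \<and> (if bval b s then wp W p (wp W (While b p) Q) s (\<tau> + (1 + bcost b))
                   else Q s (\<tau> + (1 + bcost b)))"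
    unfolding wp_def by (force elim: exec_WhileE simp: add.assoc)
next
  assume *: "bfits W b s \<and> (if bval b s then wp W p (wp W (While b p) Q) s (\<tau> + (1 + bcost b))
                   else Q s (\<tau> + (1 + bcost b)))"
  show "wp W (While b p) Q s \<tau>"
  proof (cases "bval b s")
    case True
    with * obtain t1 s1 t2 s2 where "exec W p s t1 s1" "exec W (While b p) s1 t2 s2"
      "Q s2 (\<tau> + (1 + bcost b) + t1 + t2)"
      unfolding wp_def by auto
    then show ?thesis unfolding wp_def
      using exec_WhileTrue[of W b s p t1 s1 t2 s2] * True by (metis add.assoc)
  next
    case False
    then show ?thesis unfolding wp_def
      using exec_WhileFalse[of W b s p] * by (intro exI[of _ "1 + bcost b"] exI[of _ s]) simp
  qed
qed

definition for_loop :: "name \<Rightarrow> name \<Rightarrow> com \<Rightarrow> com" where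
  "for_loop x y p = Seq (Assign x (Const 0))
     (While (Less (Reg x) (Reg y)) (Seq p (Assign x (Add (Reg x) (Const 1)))))"

text \<open>The invariant is stated for the state in which the counter already has its new value. An
  iteration costs 4 for the test and 4 for the increment besides \<open>c i\<close>; the initial
  assignment and the last test give the 6.\<close>

lemma wp_for_loop:
  assumes W: "N < W" "1 < W" and y: "reg s y = N" "x \<noteq> y"
    and init: "J 0 (s\<lparr>reg := (reg s)(x := 0)\<rparr>)"
    and step: "\<And>i s \<tau>. i < N \<Longrightarrow> reg s x = i \<Longrightarrow> reg s y = N \<Longrightarrow> J i s \<Longrightarrow>
      wp W p (\<lambda>s' \<tau>'. reg s' x = i \<and> reg s' y = N \<and> \<tau>' \<le> \<tau> + c i \<and>
                  J (Suc i) (s'\<lparr>reg := (reg s')(x := Suc i)\<rparr>)) s \<tau>"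
    and exit: "\<And>s' \<tau>'. reg s' y = N \<Longrightarrow> J N s' \<Longrightarrow> \<tau>' \<le> \<tau> + 6 + (\<Sum>i<N. c i + 8) \<Longrightarrow> Q s' \<tau>'"
  shows "wp W (for_loop x y p) Q s \<tau>"
proof -
  let ?loop = "While (Less (Reg x) (Reg y)) (Seq p (Assign x (Add (Reg x) (Const 1))))"
  have "wp W ?loop Q s' \<tau>'"
    if "i \<le> N" "reg s' x = i" "reg s' y = N" "J i s'" "\<tau>' \<le> \<tau> + 2 + (\<Sum>i<i. c i + 8)" for i s' \<tau>'
    using that
  \<comment> \<open>The induction goes from the exit at \<open>i = N\<close> down to the first
    iteration, with the time spent so far as a premise.\<close>
  proof (induction i arbitrary: s' \<tau>' rule: inc_induct)
    case base
    then show ?case by (subst wp_While_iff) (use W in \<open>auto intro!: exit\<close>)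
  next
    case (step i)
    have "wp W p (wp W (Assign x (Add (Reg x) (Const 1))) (wp W ?loop Q)) s' (\<tau>' + 4)"
    proof (rule wp_mono[OF assms(6)])
      fix s'' \<tau>''
      assume "reg s'' x = i \<and> reg s'' y = N \<and> \<tau>'' \<le> \<tau>' + 4 + c i \<and>
                  J (Suc i) (s''\<lparr>reg := (reg s'')(x := Suc i)\<rparr>)"
      then show "wp W (Assign x (Add (Reg x) (Const 1))) (wp W ?loop Q) s'' \<tau>''"
        using step W y(2) by (auto intro!: step.IH)
    qed (use step in auto)
    then show ?case
      by (subst wp_While_iff) (use step W in \<open>simp add: numeral_eq_Suc\<close>)
  qed
  from this[of 0 "s\<lparr>reg := (reg s)(x := 0)\<rparr>" "\<tau> + 2"] show ?thesis
    unfolding for_loop_def using W y init by simp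
qed

section \<open>The algorithm\<close>

text \<open>
  Runs \<open>body\<close> for all \<open>u\<close> in the closed neighbourhoods of the vertices on the list number \<open>l\<close>;
  a vertex \<open>u\<close> may occur several times. In linked lists and labels, \<open>v + 1\<close> stands for vertex \<open>v\<close> and
  \<open>0\<close> for nil or no label. Index \<open>e = off[v + 1]\<close>, one past the neighbours of \<open>v\<close>, stands for \<open>v\<close> itself.
\<close>

definition scan :: "com \<Rightarrow> com" where
  "scan body = Seq (Assign ''v'' (Read ''hd'' (Reg ''l'')))
     (While (Less (Const 0) (Reg ''v''))
       (Seq (Assign ''e'' (Read ''off'' (Sub (Reg ''v'') (Const 1))))
       (Seq (While (Less (Reg ''e'') (Add (Read ''off'' (Reg ''v'')) (Const 1)))
              (Seq (If (Less (Reg ''e'') (Read ''off'' (Reg ''v'')))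
                     (Assign ''u'' (Read ''adj'' (Reg ''e'')))
                     (Assign ''u'' (Sub (Reg ''v'') (Const 1))))
              (Seq body
                   (Assign ''e'' (Add (Reg ''e'') (Const 1))))))
            (Assign ''v'' (Read ''nxt'' (Sub (Reg ''v'') (Const 1)))))))"

text \<open>Any live label met will do; the last one found is kept, and \<open>c\<close> stays
  \<open>0\<close> if there is none. Unlabelled vertices are skipped because \<open>alv[0]\<close>
  is \<open>0\<close>.\<close>

definition pick :: com where
  "pick = If (Less (Const 0) (Read ''alv'' (Read ''own'' (Reg ''u''))))
     (Assign ''c'' (Read ''own'' (Reg ''u''))) Skip"

text \<open>The test says \<open>own[u] = c\<close> or \<open>c = 0\<close>, in the available
  connectives. Repeated visits to \<open>u\<close> are harmless: they store \<open>l\<close> again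
  or do nothing.\<close>

definition mark :: com where
  "mark = If (Not (And (Not (Eq (Read ''own'' (Reg ''u'')) (Reg ''c''))) (Not (Eq (Reg ''c'') (Const 0)))))
     (Store ''own'' (Reg ''u'') (Reg ''l'')) Skip"

text \<open>
  Inserts the expanded set number \<open>l\<close>. If it meets the live set \<open>c\<close>, then \<open>c\<close> dies and the intersection
  becomes the live set \<open>l\<close>. Vertices of \<open>c\<close> outside the intersection keep their dead label, since
  relabelling them would cost too much time.
\<close>

definition merge :: com where
  "merge = Seq (Assign ''l'' (Add (Reg ''j'') (Const 1)))
     (If (Less (Const 0) (Read ''hd'' (Reg ''l'')))
       (Seq (Assign ''c'' (Const 0))
       (Seq (scan pick)
       (Seq (scan mark)
       (Seq (Store ''alv'' (Reg ''c'') (Const 0))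
            (Store ''alv'' (Reg ''l'') (Const 1))))))
       Skip)"

definition reset :: com where
  "reset = Seq (Store ''hd'' (Const 0) (Const 0))
     (Seq (Store ''alv'' (Const 0) (Const 0))
     (for_loop ''i'' ''n''
       (Seq (Store ''hd'' (Add (Reg ''i'') (Const 1)) (Const 0))
       (Seq (Store ''alv'' (Add (Reg ''i'') (Const 1)) (Const 0))
            (Store ''own'' (Reg ''i'') (Const 0))))))"

text \<open>Vertices are pushed to the front, so each list is decreasing. List \<open>0\<close>
  collects the unlabelled vertices and is never scanned.\<close>

definition link :: com where
  "link = for_loop ''i'' ''n''
     (Seq (Store ''nxt'' (Reg ''i'') (Read ''hd'' (Read ''lab'' (Reg ''i''))))
          (Store ''hd'' (Read ''lab'' (Reg ''i'')) (Add (Reg ''i'') (Const 1))))"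

definition relabel :: com where
  "relabel = for_loop ''i'' ''n''
     (If (Less (Const 0) (Read ''alv'' (Read ''own'' (Reg ''i''))))
       (Store ''lab'' (Reg ''i'') (Read ''own'' (Reg ''i'')))
       (Store ''lab'' (Reg ''i'') (Const 0)))"

definition expand_round :: com where
  "expand_round = Seq reset (Seq link (Seq (for_loop ''j'' ''n'' merge) relabel))"

definition init :: com where
  "init = for_loop ''i'' ''n''
     (If (Less (Const 0) (Read ''A'' (Reg ''i'')))
       (Store ''lab'' (Reg ''i'') (Add (Reg ''i'') (Const 1))) Skip)"

text \<open>\<open>c\<close> becomes the first nonzero label, and \<open>g = 1\<close> reports that
  a second one occurs.\<close>

definition detect :: com where
  "detect = for_loop ''i'' ''n''
     (If (Less (Const 0) (Read ''lab'' (Reg ''i'')))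
       (If (Eq (Reg ''c'') (Const 0))
         (Assign ''c'' (Read ''lab'' (Reg ''i'')))
         (If (Eq (Reg ''c'') (Read ''lab'' (Reg ''i''))) Skip (Assign ''g'' (Const 1))))
       Skip)"

text \<open>If no label occurs, then \<open>c\<close> and all labels are \<open>0\<close>, so all
  vertices are output, as is right for empty \<open>A\<close>.\<close>

definition emit :: com where
  "emit = for_loop ''i'' ''n''
     (If (And (Eq (Reg ''g'') (Const 0)) (Eq (Read ''lab'' (Reg ''i'')) (Reg ''c'')))
       (Store ''out'' (Reg ''i'') (Const 1))
       (Store ''out'' (Reg ''i'') (Const 0)))"

text \<open>
  For \<open>n = 1\<close> there are no edges, and the time bound does not allow for \<open>k\<close> rounds.
\<close>

definition small_ecc_prog :: com where
  "small_ecc_prog = If (Less (Reg ''n'') (Const 2))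
     (Store ''out'' (Const 0) (Const 1))
     (Seq init
     (Seq (for_loop ''r'' ''k'' expand_round)
     (Seq (Assign ''c'' (Const 0))
     (Seq (Assign ''g'' (Const 0))
     (Seq detect emit)))))"

section \<open>Verification\<close>

fun chain :: "(nat \<Rightarrow> nat) \<Rightarrow> nat \<Rightarrow> nat list \<Rightarrow> bool" where
  "chain nxt h [] \<longleftrightarrow> h = 0"
| "chain nxt h (v # vs) \<longleftrightarrow> h = Suc v \<and> chain nxt (nxt v) vs"

lemma chain_cong: "(\<And>v. v \<in> set xs \<Longrightarrow> nxt v = nxt' v) \<Longrightarrow> chain nxt h xs \<longleftrightarrow> chain nxt' h xs"
  by (induction xs arbitrary: h) auto

lemma chain_head_le: "chain nxt h xs \<Longrightarrow> set xs \<subseteq> {..<n} \<Longrightarrow> h \<le> n"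
  by (cases xs) auto

text \<open>Writes the cost of scanning one list as a sum over all vertices, so that the costs of
  all lists can be added by exchanging sums.\<close>

lemma sum_list_rev_filter_upt:
  fixes h :: "nat \<Rightarrow> nat"
  shows "(\<Sum>v\<leftarrow>rev (filter P [0..<n]). h v) = (\<Sum>v<n. if P v then h v else 0)"
  by (induction n) (auto simp: rev_map[symmetric])

lemma nth_concat_take:
  assumes "v < length xss" "i < length (xss ! v)"
  shows "length (concat (take v xss)) + i < length (concat xss)"
    "concat xss ! (length (concat (take v xss)) + i) = xss ! v ! i"
proof -
  have eq: "concat xss = concat (take v xss) @ xss ! v @ concat (drop (Suc v) xss)"
    using assms(1) by (metis concat.simps(2) concat_append id_take_nth_drop)
  show "length (concat (take v xss)) + i < length (concat xss)"
    by (subst eq) (use assms(2) in simp)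
  show "concat xss ! (length (concat (take v xss)) + i) = xss ! v ! i"
    by (subst eq) (use assms(2) in \<open>simp add: nth_append\<close>)
qed

text \<open>The bound on \<open>W\<close> reflects that offsets are at most \<open>n * n\<close>,
  labels and list heads at most \<open>n\<close>, and the round counter at most \<open>k\<close>;
  the \<open>3\<close> leaves room for an index running past a list and for small constants.\<close>

locale adjacency =
  fixes n k :: nat and ns :: "nat list list" and W :: nat
  assumes length_ns: "length ns = n"
    and nbrs: "\<And>v. v < n \<Longrightarrow> distinct (ns ! v) \<and> set (ns ! v) \<subseteq> {..<n}"
    and W: "n * n + n + k + 3 < W"
begin

definition off :: "nat \<Rightarrow> nat" where
  "off v = (if v \<le> n then length (concat (take v ns)) else 0)"

definition adj :: "nat \<Rightarrow> nat" where
  "adj j = (if j < length (concat ns) then concat ns ! j else 0)"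

definition nbhd :: "nat \<Rightarrow> nat set" where
  "nbhd v = insert v (set (ns ! v))"

definition deg :: "nat \<Rightarrow> nat" where
  "deg v = length (ns ! v)"

text \<open>Cost of one scan charged to \<open>v\<close>: each of the \<open>deg v + 1\<close>
  visits costs at most 20 for \<open>pick\<close> or \<open>mark\<close> and 25 for the loop around
  it; 30 is the overhead per list node.\<close>

definition work :: "nat \<Rightarrow> nat" where
  "work v = Suc (deg v) * 45 + 30"

definition input :: "nat \<Rightarrow> state \<Rightarrow> bool" where
  "input r s \<longleftrightarrow> reg s ''n'' = n \<and> reg s ''k'' = k \<and> reg s ''r'' = r \<and>
    mem s ''off'' = off \<and> mem s ''adj'' = adj"

lemma off_Suc: "v < n \<Longrightarrow> off (Suc v) = off v + deg v"
  using length_ns by (simp add: off_def deg_def take_Suc_conv_app_nth)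

lemma adj_off: "v < n \<Longrightarrow> i < deg v \<Longrightarrow> adj (off v + i) = ns ! v ! i"
  using nth_concat_take[of v ns i] length_ns by (simp add: adj_def off_def deg_def)

lemma deg_le: "v < n \<Longrightarrow> deg v \<le> n"
  using nbrs[of v] card_mono[of "{..<n}" "set (ns ! v)"] distinct_card[of "ns ! v"]
  by (simp add: deg_def)

lemma off_le: "v \<le> n \<Longrightarrow> off v \<le> v * n"
proof (induction v)
  case 0
  then show ?case by (simp add: off_def)
next
  case (Suc v)
  then show ?case using off_Suc[of v] deg_le[of v] by simp
qed

lemma off_lt_W: "v \<le> n \<Longrightarrow> off v + 3 < W"
  using order_trans[OF off_le[of v] mult_le_mono1[of v n n]] W by simp

lemma nbhd_subset: "v < n \<Longrightarrow> nbhd v \<subseteq> {..<n}"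
  using nbrs[of v] by (auto simp: nbhd_def)

section \<open>Scanning closed neighbourhoods along a linked list\<close>

context
  fixes J :: "nat set \<Rightarrow> state \<Rightarrow> bool" and body :: com and nxt :: "nat \<Rightarrow> nat" and c :: nat
  assumes J_mem: "\<And>X s. J X s \<Longrightarrow> mem s ''off'' = off \<and> mem s ''adj'' = adj \<and> mem s ''nxt'' = nxt"
    and J_reg: "\<And>X s x a. J X s \<Longrightarrow> x \<in> {''v'', ''e'', ''u''} \<Longrightarrow> J X (s\<lparr>reg := (reg s)(x := a)\<rparr>)"
    and body: "\<And>X s u \<tau>. u < n \<Longrightarrow> reg s ''u'' = u \<Longrightarrow> J X s \<Longrightarrow>
      wp W body (\<lambda>s' \<tau>'. J (insert u X) s' \<and> reg s' ''v'' = reg s ''v'' \<and>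
        reg s' ''e'' = reg s ''e'' \<and> \<tau>' \<le> \<tau> + c) s \<tau>"
begin

text \<open>Index \<open>off v + i\<close> corresponds to position \<open>i\<close> in
  \<open>ns ! v @ [v]\<close>, so \<open>v\<close> itself comes last. The invariant \<open>J\<close>
  depends only on the set of visited vertices, since a vertex may recur.\<close>

lemma wp_scan_nbhd:
  assumes v: "v < n" and i: "i \<le> length (ns ! v @ [v])"
    and "J (X \<union> set (take i (ns ! v @ [v]))) s" "reg s ''v'' = Suc v" "reg s ''e'' = off v + i"
    and "\<And>s' \<tau>'. J (X \<union> nbhd v) s' \<Longrightarrow> reg s' ''v'' = Suc v \<Longrightarrow>
      \<tau>' \<le> \<tau> + (Suc (deg v) - i) * (c + 25) + 10 \<Longrightarrow> Q s' \<tau>'"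
  shows "wp W (While (Less (Reg ''e'') (Add (Read ''off'' (Reg ''v'')) (Const 1)))
              (Seq (If (Less (Reg ''e'') (Read ''off'' (Reg ''v'')))
                     (Assign ''u'' (Read ''adj'' (Reg ''e'')))
                     (Assign ''u'' (Sub (Reg ''v'') (Const 1))))
              (Seq body
                   (Assign ''e'' (Add (Reg ''e'') (Const 1)))))) Q s \<tau>"
    (is "wp W ?loop Q s \<tau>")
  using i assms(3-)
proof (induction i arbitrary: s \<tau> rule: inc_induct)
  case base
  have [simp]: "mem s ''off'' = off" using J_mem[OF base(1)] by simp
  have len: "reg s ''e'' = Suc (off (Suc v))" using base v by (simp add: off_Suc deg_def)
  have "Q s (\<tau> + 7)"
    by (rule base(4)) (use base in \<open>simp_all add: nbhd_def deg_def Un_commute\<close>)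
  then show ?case
    by (subst wp_While_iff)
      (use base(2) len off_lt_W[of "Suc v"] v W in \<open>simp add: numeral_eq_Suc\<close>)
next
  case (step i)
  let ?L = "ns ! v @ [v]"
  let ?X = "X \<union> set (take i ?L)"
  have [simp]: "mem s ''off'' = off" "mem s ''adj'' = adj" using J_mem[OF step(4)] by simp_all
  have i: "i < Suc (deg v)" using step(2) by (simp add: deg_def)
  have Li: "?L ! i < n"
    using nbrs[OF v] v i by (auto simp: nth_append deg_def) (meson lessThan_iff nth_mem subsetD)
  let ?s = "s\<lparr>reg := (reg s)(''u'' := ?L ! i)\<rparr>"
  have next_set: "X \<union> set (take (Suc i) ?L) = insert (?L ! i) ?X"
    using step(2) by (subst take_Suc_conv_app_nth) auto
  \<comment> \<open>Reaching the body takes 15 units if \<open>u\<close> is read from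
    \<open>adj\<close> and 16 if \<open>u\<close> is \<open>v\<close> itself.\<close>
  have "wp W body (wp W (Assign ''e'' (Add (Reg ''e'') (Const 1))) (wp W ?loop Q)) ?s (\<tau> + \<delta>)"
    if \<delta>: "\<delta> \<le> 16" for \<delta>
  proof (rule wp_mono[OF body[where u = "?L ! i" and X = ?X]])
    show "J ?X ?s" using step(4) by (intro J_reg) auto
    fix s' \<tau>'
    assume *: "J (insert (?L ! i) ?X) s' \<and> reg s' ''v'' = reg ?s ''v'' \<and>
        reg s' ''e'' = reg ?s ''e'' \<and> \<tau>' \<le> \<tau> + \<delta> + c"
    let ?s' = "s'\<lparr>reg := (reg s')(''e'' := Suc (reg s' ''e''))\<rparr>"
    have "wp W ?loop Q ?s' (\<tau>' + 4)"
    proof (rule step.IH)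
      show "J (X \<union> set (take (Suc i) ?L)) ?s'"
        unfolding next_set using * by (intro J_reg) auto
      show "reg ?s' ''v'' = Suc v" "reg ?s' ''e'' = off v + Suc i" using * step by simp_all
      fix s'' \<tau>''
      assume "J (X \<union> nbhd v) s''" "reg s'' ''v'' = Suc v"
        "\<tau>'' \<le> \<tau>' + 4 + (Suc (deg v) - Suc i) * (c + 25) + 10"
      moreover have "Suc (deg v) - i = Suc (Suc (deg v) - Suc i)" using i by simp
      ultimately show "Q s'' \<tau>''"
        using * \<delta> by (intro step(7)) simp_all
    qed
    moreover have "Suc (reg s' ''e'') < W"
      using * step(6) i off_lt_W[of "Suc v"] v by (simp add: off_Suc)
    ultimately show "wp W (Assign ''e'' (Add (Reg ''e'') (Const 1))) (wp W ?loop Q) s' \<tau>'"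
      using W by (simp add: numeral_eq_Suc)
  qed (use Li in simp_all)
  note body' = this
  have e: "reg s ''e'' = off v + i" "reg s ''v'' = Suc v" using step by simp_all
  have ovf: "off (Suc v) + 3 < W" "Suc v < W" "Suc 0 < W" using off_lt_W[of "Suc v"] v W by auto
  show ?case
  proof (cases "i < deg v")
    case True
    then have "?L ! i = ns ! v ! i" by (simp add: nth_append deg_def)
    moreover have "adj (off v + i) = ns ! v ! i" by (rule adj_off[OF v True])
    ultimately show ?thesis
      using body'[of 15] Li True e ovf v W
      by (subst wp_While_iff) (simp add: off_Suc numeral_eq_Suc)
  next
    case False
    then have "i = deg v" using i by simp
    then have "?L ! i = v" by (simp add: nth_append deg_def)
    then show ?thesis
      using body'[of 16] \<open>i = deg v\<close> e ovf v W
      by (subst wp_While_iff) (simp add: off_Suc numeral_eq_Suc)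
  qed
qed

text \<open>As \<open>J\<close> fixes the array \<open>nxt\<close>, the body cannot disturb the list
  being traversed. Per node, 30 covers the outer test, the assignments to \<open>e\<close> and
  \<open>v\<close>, and the exit of the inner loop.\<close>

lemma wp_scan:
  assumes "chain nxt (mem s ''hd'' (reg s ''l'')) xs" "set xs \<subseteq> {..<n}" "J {} s" "reg s ''l'' < W"
    and "\<And>s' \<tau>'. J (\<Union>v\<in>set xs. nbhd v) s' \<Longrightarrow>
      \<tau>' \<le> \<tau> + 10 + (\<Sum>v\<leftarrow>xs. Suc (deg v) * (c + 25) + 30) \<Longrightarrow> Q s' \<tau>'"
  shows "wp W (scan body) Q s \<tau>"
proof -
  define inner where "inner = While (Less (Reg ''e'') (Add (Read ''off'' (Reg ''v'')) (Const 1)))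
              (Seq (If (Less (Reg ''e'') (Read ''off'' (Reg ''v'')))
                     (Assign ''u'' (Read ''adj'' (Reg ''e'')))
                     (Assign ''u'' (Sub (Reg ''v'') (Const 1))))
              (Seq body
                   (Assign ''e'' (Add (Reg ''e'') (Const 1)))))"
  define loop where "loop = While (Less (Const 0) (Reg ''v''))
       (Seq (Assign ''e'' (Read ''off'' (Sub (Reg ''v'') (Const 1))))
       (Seq inner (Assign ''v'' (Read ''nxt'' (Sub (Reg ''v'') (Const 1))))))"
  have "wp W loop Q s \<tau>"
    if "chain nxt (reg s ''v'') xs" "set xs \<subseteq> {..<n}" "J X s"
      "\<And>s' \<tau>'. J (X \<union> (\<Union>v\<in>set xs. nbhd v)) s' \<Longrightarrow>
        \<tau>' \<le> \<tau> + 5 + (\<Sum>v\<leftarrow>xs. Suc (deg v) * (c + 25) + 30) \<Longrightarrow> Q s' \<tau>'" for xs s \<tau> X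
    using that
  proof (induction xs arbitrary: s \<tau> X)
    case Nil
    have "Q s (\<tau> + 4)" using Nil(3) by (intro Nil(4)) auto
    then show ?case
      unfolding loop_def using Nil(1) W by (subst wp_While_iff) (simp add: numeral_eq_Suc)
  next
    case (Cons v xs)
    have v: "v < n" and reg_v: "reg s ''v'' = Suc v" using Cons(2,3) by auto
    have nxt_v: "nxt v \<le> n" by (rule chain_head_le[of nxt _ xs]) (use Cons(2,3) in auto)
    have off: "mem s ''off'' = off" using J_mem[OF Cons(4)] by simp
    let ?s = "s\<lparr>reg := (reg s)(''e'' := off v)\<rparr>"
    have "wp W inner (wp W (Assign ''v'' (Read ''nxt'' (Sub (Reg ''v'') (Const 1)))) (wp W loop Q)) ?s (\<tau> + 9)"
      unfolding inner_def
    proof (rule wp_scan_nbhd[where v = v and i = 0 and X = X])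
      show "J (X \<union> set (take 0 (ns ! v @ [v]))) ?s" using J_reg[OF Cons(4)] by simp
      fix s' \<tau>'
      assume s': "J (X \<union> nbhd v) s'" "reg s' ''v'' = Suc v"
        "\<tau>' \<le> \<tau> + 9 + (Suc (deg v) - 0) * (c + 25) + 10"
      have nxt: "mem s' ''nxt'' = nxt" using J_mem[OF s'(1)] by simp
      have "wp W loop Q (s'\<lparr>reg := (reg s')(''v'' := nxt v)\<rparr>) (\<tau>' + 5)"
      proof (rule Cons.IH)
        show "chain nxt (reg (s'\<lparr>reg := (reg s')(''v'' := nxt v)\<rparr>) ''v'') xs" "set xs \<subseteq> {..<n}"
          using Cons(2,3) by auto
        show "J (X \<union> nbhd v) (s'\<lparr>reg := (reg s')(''v'' := nxt v)\<rparr>)"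
          using s'(1) by (intro J_reg) auto
        fix s'' \<tau>''
        assume "J (X \<union> nbhd v \<union> (\<Union>v\<in>set xs. nbhd v)) s''"
          "\<tau>'' \<le> \<tau>' + 5 + 5 + (\<Sum>v\<leftarrow>xs. Suc (deg v) * (c + 25) + 30)"
        then show "Q s'' \<tau>''" using s'(3) by (intro Cons(5)) (simp_all add: Un_assoc)
      qed
      then show "wp W (Assign ''v'' (Read ''nxt'' (Sub (Reg ''v'') (Const 1)))) (wp W loop Q) s' \<tau>'"
        using s'(2) nxt nxt_v v W by (simp add: numeral_eq_Suc)
    qed (use v reg_v in simp_all)
    then show ?case
      unfolding loop_def
      using off reg_v v W off_lt_W[of v] by (subst wp_While_iff) (simp add: numeral_eq_Suc)
  qed
  note loop = this
  let ?s = "s\<lparr>reg := (reg s)(''v'' := mem s ''hd'' (reg s ''l''))\<rparr>"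
  have "wp W loop Q ?s (\<tau> + 3)"
  proof (rule loop)
    show "chain nxt (reg ?s ''v'') xs" using assms(1) by simp
    show "J {} ?s" using assms(3) by (intro J_reg) auto
  qed (use assms in auto)
  then show ?thesis
    unfolding scan_def loop_def inner_def
    using chain_head_le[OF assms(1,2)] assms(4) W by (simp add: numeral_eq_Suc)
qed

end

lemma input_reg [simp]:
  "x \<notin> {''n'', ''k'', ''r''} \<Longrightarrow> input r (s\<lparr>reg := (reg s)(x := a)\<rparr>) \<longleftrightarrow> input r s"
  by (auto simp: input_def)

lemma input_mem [simp]:
  "x \<notin> {''off'', ''adj''} \<Longrightarrow> input r (s\<lparr>mem := (mem s)(x := a)\<rparr>) \<longleftrightarrow> input r s"
  by (auto simp: input_def)

lemma input_n: "input r s \<Longrightarrow> reg s ''n'' = n"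
  by (simp add: input_def)

lemma n_lt_W: "n < W" "Suc n < W" "1 < W"
  using W by auto

section \<open>Clearing, linking and relabelling\<close>

lemma wp_reset:
  assumes "input r s"
    and exit: "\<And>s' \<tau>'. input r s' \<Longrightarrow> mem s' ''lab'' = mem s ''lab'' \<Longrightarrow>
      \<forall>x\<le>n. mem s' ''hd'' x = 0 \<and> mem s' ''alv'' x = 0 \<Longrightarrow> \<forall>x<n. mem s' ''own'' x = 0 \<Longrightarrow>
      \<tau>' \<le> \<tau> + 30 * Suc n \<Longrightarrow> Q s' \<tau>'"
  shows "wp W reset Q s \<tau>"
proof -
  define s1 where "s1 = s\<lparr>mem := (mem s)
    (''hd'' := (mem s ''hd'')(0 := 0), ''alv'' := (mem s ''alv'')(0 := 0))\<rparr>"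
  define J where "J i s' \<longleftrightarrow> input r s' \<and> mem s' ''lab'' = mem s ''lab'' \<and>
    (\<forall>x\<le>i. mem s' ''hd'' x = 0 \<and> mem s' ''alv'' x = 0) \<and> (\<forall>x<i. mem s' ''own'' x = 0)" for i s'
  have "wp W (for_loop ''i'' ''n''
       (Seq (Store ''hd'' (Add (Reg ''i'') (Const 1)) (Const 0))
       (Seq (Store ''alv'' (Add (Reg ''i'') (Const 1)) (Const 0))
            (Store ''own'' (Reg ''i'') (Const 0))))) Q s1 (\<tau> + 6)"
  proof (rule wp_for_loop[where N = n and J = J and c = "\<lambda>_. 13"])
    show "reg s1 ''n'' = n" using assms(1) by (simp add: s1_def input_def)
    show "J 0 (s1\<lparr>reg := (reg s1)(''i'' := 0)\<rparr>)"
      using assms(1) by (simp add: J_def s1_def input_def)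
  next
    fix i s' \<tau>'
    assume "i < n" "reg s' ''i'' = i" "reg s' ''n'' = n" "J i s'"
    then show "wp W (Seq (Store ''hd'' (Add (Reg ''i'') (Const 1)) (Const 0))
       (Seq (Store ''alv'' (Add (Reg ''i'') (Const 1)) (Const 0))
            (Store ''own'' (Reg ''i'') (Const 0))))
       (\<lambda>s'' \<tau>''. reg s'' ''i'' = i \<and> reg s'' ''n'' = n \<and> \<tau>'' \<le> \<tau>' + 13 \<and>
          J (Suc i) (s''\<lparr>reg := (reg s'')(''i'' := Suc i)\<rparr>)) s' \<tau>'"
      using W by (auto simp: J_def input_def less_Suc_eq le_Suc_eq)
  next
    fix s' \<tau>'
    assume "J n s'" "\<tau>' \<le> \<tau> + 6 + 6 + (\<Sum>i<n. 13 + 8)"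
    then show "Q s' \<tau>'" unfolding J_def by (intro exit) auto
  qed (use n_lt_W in auto)
  then show ?thesis
    unfolding reset_def s1_def using W by (simp add: numeral_eq_Suc fun_upd_twist)
qed

lemma wp_link:
  assumes "input r s" "\<forall>x\<le>n. mem s ''hd'' x = 0" "\<forall>v<n. mem s ''lab'' v \<le> n"
    and exit: "\<And>s' \<tau>'. input r s' \<Longrightarrow> mem s' ''lab'' = mem s ''lab'' \<Longrightarrow>
      mem s' ''own'' = mem s ''own'' \<Longrightarrow> mem s' ''alv'' = mem s ''alv'' \<Longrightarrow>
      \<forall>l\<le>n. chain (mem s' ''nxt'') (mem s' ''hd'' l) (rev (filter (\<lambda>v. mem s ''lab'' v = l) [0..<n])) \<Longrightarrow>
      \<tau>' \<le> \<tau> + 30 * Suc n \<Longrightarrow> Q s' \<tau>'"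
  shows "wp W link Q s \<tau>"
proof -
  define lab where "lab = mem s ''lab''"
  define J where "J i s' \<longleftrightarrow> input r s' \<and> mem s' ''lab'' = lab \<and>
    mem s' ''own'' = mem s ''own'' \<and> mem s' ''alv'' = mem s ''alv'' \<and>
    (\<forall>l\<le>n. chain (mem s' ''nxt'') (mem s' ''hd'' l) (rev (filter (\<lambda>v. lab v = l) [0..<i])))" for i s'
  show ?thesis
    unfolding link_def
  proof (rule wp_for_loop[where N = n and J = J and c = "\<lambda>_. 11"])
    show "reg s ''n'' = n" using assms(1) by (simp add: input_def)
    show "J 0 (s\<lparr>reg := (reg s)(''i'' := 0)\<rparr>)"
      using assms(1,2) by (simp add: J_def lab_def)
  next
    fix i s' \<tau>'
    assume i: "i < n" "reg s' ''i'' = i" "reg s' ''n'' = n" "J i s'"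
    have li: "lab i \<le> n" using i assms(3) by (simp add: lab_def)
    have "chain (mem s' ''nxt'') (mem s' ''hd'' (lab i)) (rev (filter (\<lambda>v. lab v = lab i) [0..<i]))"
      using i(4) li by (simp add: J_def)
    then have hd: "mem s' ''hd'' (lab i) \<le> n"
      by (rule chain_head_le) (use i(1) in auto)
    \<comment> \<open>Vertex \<open>i\<close> is on none of the lists built so far, so setting its
      successor leaves them intact.\<close>
    have "chain ((mem s' ''nxt'')(i := a)) h (rev (filter (\<lambda>v. lab v = l) [0..<i])) \<longleftrightarrow>
        chain (mem s' ''nxt'') h (rev (filter (\<lambda>v. lab v = l) [0..<i]))" for a h l
      by (rule chain_cong) auto
    then show "wp W (Seq (Store ''nxt'' (Reg ''i'') (Read ''hd'' (Read ''lab'' (Reg ''i''))))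
          (Store ''hd'' (Read ''lab'' (Reg ''i'')) (Add (Reg ''i'') (Const 1))))
       (\<lambda>s'' \<tau>''. reg s'' ''i'' = i \<and> reg s'' ''n'' = n \<and> \<tau>'' \<le> \<tau>' + 11 \<and>
          J (Suc i) (s''\<lparr>reg := (reg s'')(''i'' := Suc i)\<rparr>)) s' \<tau>'"
      using W i li hd by (auto simp: J_def input_def)
  next
    fix s' \<tau>'
    assume "J n s'" "\<tau>' \<le> \<tau> + 6 + (\<Sum>i<n. 11 + 8)"
    then show "Q s' \<tau>'" unfolding J_def lab_def by (intro exit) auto
  qed (use n_lt_W in auto)
qed

lemma wp_relabel:
  assumes "input r s" "\<forall>v<n. mem s ''own'' v \<le> n" "\<forall>l\<le>n. mem s ''alv'' l \<le> 1"
    and exit: "\<And>s' \<tau>'. input r s' \<Longrightarrow>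
      \<forall>v<n. mem s' ''lab'' v = (if mem s ''alv'' (mem s ''own'' v) \<noteq> 0 then mem s ''own'' v else 0) \<Longrightarrow>
      \<tau>' \<le> \<tau> + 30 * Suc n \<Longrightarrow> Q s' \<tau>'"
  shows "wp W relabel Q s \<tau>"
proof -
  define own where "own = mem s ''own''"
  define alv where "alv = mem s ''alv''"
  define J where "J i s' \<longleftrightarrow> input r s' \<and> mem s' ''own'' = own \<and> mem s' ''alv'' = alv \<and>
    (\<forall>v<i. mem s' ''lab'' v = (if alv (own v) \<noteq> 0 then own v else 0))" for i s'
  show ?thesis
    unfolding relabel_def
  proof (rule wp_for_loop[where N = n and J = J and c = "\<lambda>_. 15"])
    show "reg s ''n'' = n" using assms(1) by (simp add: input_def)
    show "J 0 (s\<lparr>reg := (reg s)(''i'' := 0)\<rparr>)"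
      using assms(1) by (simp add: J_def own_def alv_def)
  next
    fix i s' \<tau>'
    assume i: "i < n" "reg s' ''i'' = i" "reg s' ''n'' = n" "J i s'"
    have "own i \<le> n" using i assms(2) by (simp add: own_def)
    moreover from this have "alv (own i) \<le> 1" using assms(3) by (simp add: alv_def)
    ultimately show "wp W (If (Less (Const 0) (Read ''alv'' (Read ''own'' (Reg ''i''))))
         (Store ''lab'' (Reg ''i'') (Read ''own'' (Reg ''i'')))
         (Store ''lab'' (Reg ''i'') (Const 0)))
       (\<lambda>s'' \<tau>''. reg s'' ''i'' = i \<and> reg s'' ''n'' = n \<and> \<tau>'' \<le> \<tau>' + 15 \<and>
          J (Suc i) (s''\<lparr>reg := (reg s'')(''i'' := Suc i)\<rparr>)) s' \<tau>'"
      using W i by (auto simp: J_def less_Suc_eq)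
  next
    fix s' \<tau>'
    assume "J n s'" "\<tau>' \<le> \<tau> + 6 + (\<Sum>i<n. 15 + 8)"
    then show "Q s' \<tau>'" unfolding J_def own_def alv_def by (intro exit) auto
  qed (use n_lt_W in auto)
qed

section \<open>Inserting the expanded sets one by one\<close>

context
  fixes near' :: "nat \<Rightarrow> nat \<Rightarrow> bool" and A :: "nat set" and f lab hd nxt :: "nat \<Rightarrow> nat" and r :: nat
begin

text \<open>Invariant after the sets numbered up to \<open>j\<close> have been inserted. The bounds
  on \<open>own\<close> and \<open>alv\<close> make \<open>Suc j\<close> a fresh label;
  \<open>own\<close> may still contain dead labels.\<close>

definition merged :: "nat \<Rightarrow> state \<Rightarrow> bool" where
  "merged j s \<longleftrightarrow> input r s \<and> mem s ''hd'' = hd \<and> mem s ''nxt'' = nxt \<and>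
    (\<forall>v<n. mem s ''own'' v \<le> j) \<and> mem s ''alv'' 0 = 0 \<and>
    (\<forall>l\<le>n. mem s ''alv'' l \<le> 1 \<and> (j < l \<longrightarrow> mem s ''alv'' l = 0)) \<and>
    grouped n near' {a \<in> A. f a \<le> j} (mem s ''own'') {l. l \<le> n \<and> mem s ''alv'' l \<noteq> 0}"

context
  assumes f: "f ` A = labels n lab"
    and expand: "\<And>l. l \<in> labels n lab \<Longrightarrow> (\<Union>v\<in>{v. v < n \<and> lab v = l}. nbhd v) =
      {u. u < n \<and> (\<forall>a\<in>{a \<in> A. f a = l}. near' a u)}"
    and chains: "\<And>l. l \<le> n \<Longrightarrow> chain nxt (hd l) (rev (filter (\<lambda>v. lab v = l) [0..<n]))"
begin

lemma wp_scan_pick: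
  assumes "merged j s" "j < n" "reg s ''j'' = j" "reg s ''l'' = Suc j" "reg s ''c'' = 0"
    and S: "S = (\<Union>v\<in>{v. v < n \<and> lab v = Suc j}. nbhd v)"
    and exit: "\<And>s' \<tau>'. input r s' \<Longrightarrow> mem s' = mem s \<Longrightarrow> reg s' ''j'' = j \<Longrightarrow> reg s' ''l'' = Suc j \<Longrightarrow>
      reg s' ''c'' = 0 \<and> (\<forall>u\<in>S. mem s ''alv'' (mem s ''own'' u) = 0) \<or>
      reg s' ''c'' \<le> n \<and> mem s ''alv'' (reg s' ''c'') \<noteq> 0 \<and> (\<exists>u\<in>S. mem s ''own'' u = reg s' ''c'') \<Longrightarrow>
      \<tau>' \<le> \<tau> + 10 + (\<Sum>v<n. if lab v = Suc j then work v else 0) \<Longrightarrow> Q s' \<tau>'"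
  shows "wp W (scan pick) Q s \<tau>"
proof -
  let ?own = "mem s ''own''" and ?alv = "mem s ''alv''"
  let ?xs = "rev (filter (\<lambda>v. lab v = Suc j) [0..<n])"
  define J where "J X s' \<longleftrightarrow> input r s' \<and> mem s' = mem s \<and> reg s' ''j'' = j \<and> reg s' ''l'' = Suc j \<and>
    (reg s' ''c'' = 0 \<and> (\<forall>u\<in>X. ?alv (?own u) = 0) \<or>
      reg s' ''c'' \<le> n \<and> ?alv (reg s' ''c'') \<noteq> 0 \<and> (\<exists>u\<in>X. ?own u = reg s' ''c''))" for X s'
  have S': "S = (\<Union>v\<in>set ?xs. nbhd v)" unfolding S by auto
  show ?thesis
  proof (rule wp_scan[where J = J and nxt = nxt and c = 20 and xs = ?xs])
    show "mem s' ''off'' = off \<and> mem s' ''adj'' = adj \<and> mem s' ''nxt'' = nxt" if "J X s'" for X s'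
      using that assms(1) by (auto simp: J_def merged_def input_def)
    show "J X (s'\<lparr>reg := (reg s')(x := a)\<rparr>)" if "J X s'" "x \<in> {''v'', ''e'', ''u''}" for X s' x a
      using that by (auto simp: J_def)
    show "wp W pick (\<lambda>s'' \<tau>''. J (insert u X) s'' \<and> reg s'' ''v'' = reg s' ''v'' \<and>
        reg s'' ''e'' = reg s' ''e'' \<and> \<tau>'' \<le> \<tau>' + 20) s' \<tau>'"
      if "u < n" "reg s' ''u'' = u" "J X s'" for X s' u \<tau>'
    proof -
      have "?own u \<le> n" using assms(1,2) that(1) by (force simp: merged_def)
      moreover from this have "?alv (?own u) \<le> 1" using assms(1) by (simp add: merged_def)
      ultimately show ?thesis
        unfolding pick_def using that W by (auto simp: J_def)
    qed
    show "chain nxt (mem s ''hd'' (reg s ''l'')) ?xs"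
      using chains[of "Suc j"] assms(1,2,4) by (simp add: merged_def)
    show "J {} s" using assms by (simp add: J_def merged_def)
    fix s' \<tau>'
    have work_sum: "(\<Sum>v\<leftarrow>?xs. Suc (deg v) * (20 + 25) + 30) = (\<Sum>v<n. if lab v = Suc j then work v else 0)"
      unfolding sum_list_rev_filter_upt work_def by (intro sum.cong refl) simp
    assume "J (\<Union>v\<in>set ?xs. nbhd v) s'"
      and "\<tau>' \<le> \<tau> + 10 + (\<Sum>v\<leftarrow>?xs. Suc (deg v) * (20 + 25) + 30)"
    then show "Q s' \<tau>'"
      unfolding S'[symmetric] J_def work_sum by (intro exit) auto
  qed (use assms W in auto)
qed

text \<open>The new labels can be described through the old ones, independently of the order and
  number of visits, because marking a vertex twice has the same effect as marking it once.\<close>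

lemma wp_scan_mark:
  assumes "input r s" "mem s ''hd'' = hd" "mem s ''nxt'' = nxt" "j < n"
    "\<forall>v<n. mem s ''own'' v \<le> n" "reg s ''j'' = j" "reg s ''l'' = Suc j" "reg s ''c'' \<le> n"
    and S: "S = (\<Union>v\<in>{v. v < n \<and> lab v = Suc j}. nbhd v)"
    and exit: "\<And>s' \<tau>'. input r s' \<Longrightarrow>
      mem s' = (mem s)(''own'' := \<lambda>u. if u \<in> S \<and> (mem s ''own'' u = reg s ''c'' \<or> reg s ''c'' = 0)
        then Suc j else mem s ''own'' u) \<Longrightarrow>
      reg s' ''j'' = j \<Longrightarrow> reg s' ''l'' = Suc j \<Longrightarrow> reg s' ''c'' = reg s ''c'' \<Longrightarrow>
      \<tau>' \<le> \<tau> + 10 + (\<Sum>v<n. if lab v = Suc j then work v else 0) \<Longrightarrow> Q s' \<tau>'"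
  shows "wp W (scan mark) Q s \<tau>"
proof -
  let ?own = "mem s ''own''" and ?c = "reg s ''c''"
  let ?xs = "rev (filter (\<lambda>v. lab v = Suc j) [0..<n])"
  define J where "J X s' \<longleftrightarrow> input r s' \<and>
    mem s' = (mem s)(''own'' := \<lambda>u. if u \<in> X \<and> (?own u = ?c \<or> ?c = 0) then Suc j else ?own u) \<and>
    reg s' ''j'' = j \<and> reg s' ''l'' = Suc j \<and> reg s' ''c'' = ?c" for X s'
  have S': "S = (\<Union>v\<in>set ?xs. nbhd v)" unfolding S by auto
  show ?thesis
  proof (rule wp_scan[where J = J and nxt = nxt and c = 20 and xs = ?xs])
    show "mem s' ''off'' = off \<and> mem s' ''adj'' = adj \<and> mem s' ''nxt'' = nxt" if "J X s'" for X s'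
      using that assms(3) by (auto simp: J_def input_def)
    show "J X (s'\<lparr>reg := (reg s')(x := a)\<rparr>)" if "J X s'" "x \<in> {''v'', ''e'', ''u''}" for X s' x a
      using that by (auto simp: J_def)
    show "wp W mark (\<lambda>s'' \<tau>''. J (insert u X) s'' \<and> reg s'' ''v'' = reg s' ''v'' \<and>
        reg s'' ''e'' = reg s' ''e'' \<and> \<tau>'' \<le> \<tau>' + 20) s' \<tau>'"
      if "u < n" "reg s' ''u'' = u" "J X s'" for X s' u \<tau>'
    proof -
      have "?own u \<le> n" using assms(5) that(1) by simp
      then show ?thesis
        unfolding mark_def using that W assms(4,8) by (auto simp: J_def fun_eq_iff)
    qed
    show "chain nxt (mem s ''hd'' (reg s ''l'')) ?xs"
      using chains[of "Suc j"] assms(2,4,7) by simp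
    show "J {} s" using assms by (simp add: J_def)
    fix s' \<tau>'
    have work_sum: "(\<Sum>v\<leftarrow>?xs. Suc (deg v) * (20 + 25) + 30) = (\<Sum>v<n. if lab v = Suc j then work v else 0)"
      unfolding sum_list_rev_filter_upt work_def by (intro sum.cong refl) simp
    assume "J (\<Union>v\<in>set ?xs. nbhd v) s'"
      and "\<tau>' \<le> \<tau> + 10 + (\<Sum>v\<leftarrow>?xs. Suc (deg v) * (20 + 25) + 30)"
    then show "Q s' \<tau>'"
      unfolding S'[symmetric] J_def work_sum by (intro exit) auto
  qed (use assms W in auto)
qed

text \<open>The part numbers are exactly the labels that occur, so an absent label has no part to
  insert.\<close>

lemma merged_step_empty:
  assumes "merged j s" "Suc j \<notin> labels n lab"
  shows "merged (Suc j) s"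
proof -
  have "f a \<noteq> Suc j" if "a \<in> A" for a
    using imageI[OF that, of f] assms(2) unfolding f by metis
  then have "{a \<in> A. f a \<le> Suc j} = {a \<in> A. f a \<le> j}" by (auto simp: le_Suc_eq)
  then show ?thesis using assms(1) by (force simp: merged_def)
qed

text \<open>An instance of \<open>grouped_merge\<close>: by \<open>expand\<close> the scanned set
  \<open>S\<close> is the set of part \<open>Suc j\<close>, and it is nonempty as a vertex belongs
  to its own closed neighbourhood. For \<open>c = 0\<close>, killing label \<open>c\<close> changes
  nothing, as \<open>alv[0]\<close> is already \<open>0\<close>.\<close>

lemma merged_step:
  assumes m: "merged j s" and j: "j < n" "Suc j \<in> labels n lab"
    and S: "S = (\<Union>v\<in>{v. v < n \<and> lab v = Suc j}. nbhd v)"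
    and c: "c = 0 \<and> (\<forall>u\<in>S. mem s ''alv'' (mem s ''own'' u) = 0) \<or>
      c \<le> n \<and> mem s ''alv'' c \<noteq> 0 \<and> (\<exists>u\<in>S. mem s ''own'' u = c)"
    and s': "input r s'" "mem s' = (mem s)
      (''own'' := \<lambda>u. if u \<in> S \<and> (mem s ''own'' u = c \<or> c = 0) then Suc j else mem s ''own'' u,
       ''alv'' := (mem s ''alv'')(c := 0, Suc j := 1))"
  shows "merged (Suc j) s'"
proof -
  let ?own = "mem s ''own''" and ?alv = "mem s ''alv''"
  let ?L = "{l. l \<le> n \<and> ?alv l \<noteq> 0}"
  have alv0: "?alv 0 = 0" and own: "\<And>v. v < n \<Longrightarrow> ?own v \<le> j"
    and alv: "\<And>l. l \<le> n \<Longrightarrow> ?alv l \<le> 1 \<and> (j < l \<longrightarrow> ?alv l = 0)"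
    using m by (auto simp: merged_def)
  have S_eq: "S = {u. u < n \<and> (\<forall>a\<in>{a \<in> A. f a = Suc j}. near' a u)}"
    unfolding S by (rule expand[OF j(2)])
  obtain v where "v < n" "lab v = Suc j" using j(2) by auto
  then have "v \<in> S" unfolding S nbhd_def by blast
  have "grouped n near' ({a \<in> A. f a \<le> j} \<union> {a \<in> A. f a = Suc j}) (mem s' ''own'')
      (insert (Suc j) (?L - {c}))"
  proof (rule grouped_merge[where own = ?own and S = S])
    show "grouped n near' {a \<in> A. f a \<le> j} ?own ?L" using m by (simp add: merged_def)
    show "{a \<in> A. f a = Suc j} \<noteq> {}" using j(2) f by (metis (mono_tags, lifting) empty_iff imageE mem_Collect_eq)
    show "{a \<in> A. f a \<le> j} \<inter> {a \<in> A. f a = Suc j} = {}" by auto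
    show "Suc j \<notin> ?L" using alv[of "Suc j"] j(1) by auto
    show "?own v \<noteq> Suc j" if "v < n" for v using own[OF that] by simp
    have "u < n" if "u \<in> S" for u using that S_eq by blast
    then show "c = 0 \<and> (\<forall>u\<in>S. ?own u \<notin> ?L) \<or> c \<in> ?L \<and> (\<exists>u\<in>S. ?own u = c)"
      using c by auto
  qed (use S_eq \<open>v \<in> S\<close> s'(2) in auto)
  moreover have "{a \<in> A. f a \<le> j} \<union> {a \<in> A. f a = Suc j} = {a \<in> A. f a \<le> Suc j}" by auto
  moreover have "insert (Suc j) (?L - {c}) = {l. l \<le> n \<and> mem s' ''alv'' l \<noteq> 0}"
    using s'(2) j(1) by auto
  ultimately have "grouped n near' {a \<in> A. f a \<le> Suc j} (mem s' ''own'') {l. l \<le> n \<and> mem s' ''alv'' l \<noteq> 0}"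
    by simp
  then show ?thesis
    using m s' alv0 own alv j(1) by (auto simp: merged_def le_Suc_eq)
qed

text \<open>The list is empty exactly if the label does not occur. Otherwise it is scanned twice,
  whence the factor 2.\<close>

lemma wp_merge:
  assumes "merged j s" "j < n" "reg s ''j'' = j"
  shows "wp W merge (\<lambda>s' \<tau>'. merged (Suc j) s' \<and> reg s' ''j'' = j \<and>
    \<tau>' \<le> \<tau> + (60 + 2 * (\<Sum>v<n. if lab v = Suc j then work v else 0))) s \<tau>"
    (is "wp W merge ?Q s \<tau>")
proof -
  let ?K = "\<Sum>v<n. if lab v = Suc j then work v else 0"
  define S where "S = (\<Union>v\<in>{v. v < n \<and> lab v = Suc j}. nbhd v)"
  have ch: "chain nxt (hd (Suc j)) (rev (filter (\<lambda>v. lab v = Suc j) [0..<n]))"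
    using chains[of "Suc j"] assms(2) by simp
  have hd_le: "hd (Suc j) \<le> n" by (rule chain_head_le[OF ch]) auto
  have hd0: "hd (Suc j) = 0 \<longleftrightarrow> Suc j \<notin> labels n lab"
  proof -
    have "hd (Suc j) = 0 \<longleftrightarrow> rev (filter (\<lambda>v. lab v = Suc j) [0..<n]) = []"
      using ch by (cases "rev (filter (\<lambda>v. lab v = Suc j) [0..<n])") auto
    also have "\<dots> \<longleftrightarrow> Suc j \<notin> labels n lab"
      by (force simp: filter_empty_conv)
    finally show ?thesis .
  qed
  have hd: "mem s ''hd'' = hd" using assms(1) by (simp add: merged_def)
  let ?s = "s\<lparr>reg := (reg s)(''l'' := Suc j)\<rparr>"
  have m: "merged j ?s" using assms(1) by (simp add: merged_def)
  show ?thesis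
  proof (cases "hd (Suc j) = 0")
    case True
    then have "merged (Suc j) ?s" unfolding hd0 by (rule merged_step_empty[OF m])
    then show ?thesis unfolding merge_def using True assms hd W by simp
  next
    case False
    then have j_lab: "Suc j \<in> labels n lab" unfolding hd0 by (rule notnotD)
    let ?s1 = "?s\<lparr>reg := (reg ?s)(''c'' := 0)\<rparr>"
    have m1: "merged j ?s1" using assms(1) by (simp add: merged_def input_def)
    have "wp W (scan pick) (wp W (Seq (scan mark) (Seq (Store ''alv'' (Reg ''c'') (Const 0))
            (Store ''alv'' (Reg ''l'') (Const 1))))  ?Q) ?s1 (\<tau> + 11)"
    proof (rule wp_scan_pick[OF m1 assms(2) _ _ _ S_def])
      fix s2 \<tau>2
      assume s2: "input r s2" "mem s2 = mem ?s1" "reg s2 ''j'' = j" "reg s2 ''l'' = Suc j"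
        and c: "reg s2 ''c'' = 0 \<and> (\<forall>u\<in>S. mem ?s1 ''alv'' (mem ?s1 ''own'' u) = 0) \<or>
          reg s2 ''c'' \<le> n \<and> mem ?s1 ''alv'' (reg s2 ''c'') \<noteq> 0 \<and>
            (\<exists>u\<in>S. mem ?s1 ''own'' u = reg s2 ''c'')"
        and \<tau>2: "\<tau>2 \<le> \<tau> + 11 + 10 + ?K"
      have c_le: "reg s2 ''c'' \<le> n" using c by auto
      have "wp W (scan mark) (wp W (Seq (Store ''alv'' (Reg ''c'') (Const 0))
            (Store ''alv'' (Reg ''l'') (Const 1))) ?Q) s2 \<tau>2"
      proof (rule wp_scan_mark[OF s2(1) _ _ assms(2) _ s2(3,4) c_le S_def])
        show "mem s2 ''hd'' = hd" "mem s2 ''nxt'' = nxt" using m1 s2(2) by (simp_all add: merged_def)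
        show "\<forall>v<n. mem s2 ''own'' v \<le> n" using m1 s2(2) assms(2) by (force simp: merged_def)
        fix s3 \<tau>3
        assume s3: "input r s3" "mem s3 = (mem s2)
            (''own'' := \<lambda>u. if u \<in> S \<and> (mem s2 ''own'' u = reg s2 ''c'' \<or> reg s2 ''c'' = 0)
              then Suc j else mem s2 ''own'' u)"
          "reg s3 ''j'' = j" "reg s3 ''l'' = Suc j" "reg s3 ''c'' = reg s2 ''c''"
          "\<tau>3 \<le> \<tau>2 + 10 + ?K"
        let ?s4 = "s3\<lparr>mem := (mem s3)(''alv'' := (mem s3 ''alv'')(reg s2 ''c'' := 0, Suc j := 1))\<rparr>"
        have "merged (Suc j) ?s4"
        proof (rule merged_step[OF m1 assms(2) j_lab S_def c])
          show "input r ?s4" using s3(1) by simp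
          show "mem ?s4 = (mem ?s1)
            (''own'' := \<lambda>u. if u \<in> S \<and> (mem ?s1 ''own'' u = reg s2 ''c'' \<or> reg s2 ''c'' = 0)
              then Suc j else mem ?s1 ''own'' u,
             ''alv'' := (mem ?s1 ''alv'')(reg s2 ''c'' := 0, Suc j := 1))"
            by (simp add: s3(2) s2(2) cong: if_cong)
        qed
        then show "wp W (Seq (Store ''alv'' (Reg ''c'') (Const 0))
            (Store ''alv'' (Reg ''l'') (Const 1))) ?Q s3 \<tau>3"
          using s3 c_le \<tau>2 assms(2) W by simp
      qed
      then show "wp W (Seq (scan mark) (Seq (Store ''alv'' (Reg ''c'') (Const 0))
            (Store ''alv'' (Reg ''l'') (Const 1))))  ?Q s2 \<tau>2" by simp
    qed (use assms in simp_all)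
    then show ?thesis
      unfolding merge_def using False hd_le assms hd W by (simp add: numeral_eq_Suc)
  qed
qed

text \<open>Here disjointness pays off: a vertex has one label, so after exchanging the sums its
  \<open>work\<close> is charged in at most one iteration, and the total is linear in
  \<open>n\<close> plus the degree sum.\<close>

lemma wp_merge_all:
  assumes "merged 0 s"
    and exit: "\<And>s' \<tau>'. merged n s' \<Longrightarrow> \<tau>' \<le> \<tau> + 300 * (Suc n + (\<Sum>v<n. deg v)) \<Longrightarrow> Q s' \<tau>'"
  shows "wp W (for_loop ''j'' ''n'' merge) Q s \<tau>"
proof (rule wp_for_loop[where N = n and J = merged and
      c = "\<lambda>j. 60 + 2 * (\<Sum>v<n. if lab v = Suc j then work v else 0)"])
  show "reg s ''n'' = n" using assms(1) by (simp add: merged_def input_def)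
  show "merged 0 (s\<lparr>reg := (reg s)(''j'' := 0)\<rparr>)" using assms(1) by (simp add: merged_def)
next
  fix j s' \<tau>'
  assume j: "j < n" "reg s' ''j'' = j" "merged j s'"
  show "wp W merge (\<lambda>s'' \<tau>''. reg s'' ''j'' = j \<and> reg s'' ''n'' = n \<and>
      \<tau>'' \<le> \<tau>' + (60 + 2 * (\<Sum>v<n. if lab v = Suc j then work v else 0)) \<and>
      merged (Suc j) (s''\<lparr>reg := (reg s'')(''j'' := Suc j)\<rparr>)) s' \<tau>'"
    by (rule wp_mono[OF wp_merge[OF j(3,1,2)]]) (simp add: merged_def input_def)
next
  fix s' \<tau>'
  assume s': "merged n s'"
    and \<tau>': "\<tau>' \<le> \<tau> + 6 + (\<Sum>j<n. 60 + 2 * (\<Sum>v<n. if lab v = Suc j then work v else 0) + 8)"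
  have "(\<Sum>j<n. \<Sum>v<n. if lab v = Suc j then work v else 0) =
      (\<Sum>v<n. \<Sum>j<n. if lab v = Suc j then work v else 0)" by (rule sum.swap)
  also have "\<dots> \<le> (\<Sum>v<n. work v)"
  proof (rule sum_mono)
    fix v
    \<comment> \<open>Only \<open>j = lab v - 1\<close> can contribute. For \<open>lab v = 0\<close>
      truncated subtraction selects \<open>0\<close>, which is harmless for an upper bound.\<close>
    have "(\<Sum>j<n. if lab v = Suc j then work v else 0) \<le> (\<Sum>j\<in>{..<n}. if j = lab v - 1 then work v else 0)"
      by (rule sum_mono) auto
    also have "\<dots> \<le> work v" by simp
    finally show "(\<Sum>j<n. if lab v = Suc j then work v else 0) \<le> work v" .
  qed
  also have "\<dots> = 75 * n + 45 * (\<Sum>v<n. deg v)"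
    by (simp add: work_def sum.distrib sum_distrib_right[symmetric])
  finally show "Q s' \<tau>'"
    using s' \<tau>' by (intro exit) (simp_all add: sum.distrib sum_distrib_left[symmetric])
qed (use n_lt_W in auto)

end

end

section \<open>Complete rounds, initialization and output\<close>

definition has_labels :: "(nat \<Rightarrow> nat \<Rightarrow> bool) \<Rightarrow> nat set \<Rightarrow> nat \<Rightarrow> state \<Rightarrow> bool" where
  "has_labels near A r s \<longleftrightarrow> input r s \<and> (\<forall>v<n. mem s ''lab'' v \<le> n) \<and>
    grouped n near A (mem s ''lab'') (labels n (mem s ''lab''))"

text \<open>The relations stay abstract: \<open>helly\<close> and \<open>near\<close> are all that a
  round needs to know about balls of consecutive radii.\<close>

lemma wp_expand_round:
  assumes s: "has_labels near A r s"
    and helly: "\<And>E c u. E \<subseteq> A \<Longrightarrow> c < n \<Longrightarrow> \<forall>a\<in>E. near a c \<Longrightarrow> u < n \<Longrightarrow> \<forall>a\<in>E. near' a u \<Longrightarrow>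
      \<exists>w<n. u \<in> nbhd w \<and> (\<forall>a\<in>E. near a w)"
    and near: "\<And>a u w. a \<in> A \<Longrightarrow> w < n \<Longrightarrow> u \<in> nbhd w \<Longrightarrow> near a w \<Longrightarrow> near' a u"
  shows "wp W expand_round (\<lambda>s' \<tau>'. has_labels near' A r s' \<and>
    \<tau>' \<le> \<tau> + 500 * (Suc n + (\<Sum>v<n. deg v))) s \<tau>"
    (is "wp W expand_round ?Q s \<tau>")
proof -
  define lab where "lab = mem s ''lab''"
  have lab_le: "\<And>v. v < n \<Longrightarrow> lab v \<le> n" using s by (simp add: has_labels_def lab_def)
  have "grouped n near A lab (labels n lab)" using s by (simp add: has_labels_def lab_def)
  then obtain f where f: "f ` A = labels n lab"
    "\<And>l. l \<in> labels n lab \<Longrightarrow> (\<Union>v\<in>{v. v < n \<and> lab v = l}. nbhd v) =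
      {u. u < n \<and> (\<forall>a\<in>{a \<in> A. f a = l}. near' a u)}"
    by (rule grouped_expand[where near' = near' and N = nbhd]) (use helly near nbhd_subset in auto)
  show ?thesis
    unfolding expand_round_def wp_Seq
  proof (rule wp_reset)
    show "input r s" using s by (simp add: has_labels_def)
    fix s1 \<tau>1
    assume s1: "input r s1" "mem s1 ''lab'' = mem s ''lab''"
      "\<forall>x\<le>n. mem s1 ''hd'' x = 0 \<and> mem s1 ''alv'' x = 0" "\<forall>x<n. mem s1 ''own'' x = 0"
      "\<tau>1 \<le> \<tau> + 30 * Suc n"
    show "wp W link (wp W (for_loop ''j'' ''n'' merge) (wp W relabel ?Q)) s1 \<tau>1"
    proof (rule wp_link[OF s1(1)])
      show "\<forall>x\<le>n. mem s1 ''hd'' x = 0" using s1(3) by simp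
      show "\<forall>v<n. mem s1 ''lab'' v \<le> n" using s1(2) lab_le by (simp add: lab_def)
      fix s2 \<tau>2
      assume s2: "input r s2" "mem s2 ''own'' = mem s1 ''own''" "mem s2 ''alv'' = mem s1 ''alv''"
        and ch: "\<forall>l\<le>n. chain (mem s2 ''nxt'') (mem s2 ''hd'' l)
          (rev (filter (\<lambda>v. mem s1 ''lab'' v = l) [0..<n]))"
        and \<tau>2: "\<tau>2 \<le> \<tau>1 + 30 * Suc n"
      have ch': "\<And>l. l \<le> n \<Longrightarrow> chain (mem s2 ''nxt'') (mem s2 ''hd'' l)
          (rev (filter (\<lambda>v. lab v = l) [0..<n]))"
        using ch s1(2) by (simp add: lab_def)
      note ctxt = f ch'
      \<comment> \<open>Part numbers are positive since \<open>0\<close> is not a label, so the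
        insertion starts from the empty family.\<close>
      have "{a \<in> A. f a \<le> 0} = {}" using f(1) by (auto simp: set_eq_iff image_iff)
      moreover have "{l. l \<le> n \<and> mem s2 ''alv'' l \<noteq> 0} = {}" using s1(3) s2(3) by auto
      ultimately have "grouped n near' {a \<in> A. f a \<le> 0} (mem s2 ''own'')
          {l. l \<le> n \<and> mem s2 ''alv'' l \<noteq> 0}"
        by (simp only: grouped_empty)
      then have m0: "merged near' A f (mem s2 ''hd'') (mem s2 ''nxt'') r 0 s2"
        using s1(3,4) s2 by (simp add: merged_def)
      show "wp W (for_loop ''j'' ''n'' merge) (wp W relabel ?Q) s2 \<tau>2"
      proof (rule wp_merge_all[OF ctxt m0])
        fix s3 \<tau>3
        assume m: "merged near' A f (mem s2 ''hd'') (mem s2 ''nxt'') r n s3"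
          and \<tau>3: "\<tau>3 \<le> \<tau>2 + 300 * (Suc n + (\<Sum>v<n. deg v))"
        \<comment> \<open>Hence after \<open>n\<close> insertions all parts of \<open>A\<close> have
          been taken into account.\<close>
        have fa: "f a \<le> n" if "a \<in> A" for a
        proof -
          have "f a \<in> labels n lab" using f(1) that by (metis imageI)
          then show ?thesis using lab_le by auto
        qed
        have s3: "input r s3" "\<forall>v<n. mem s3 ''own'' v \<le> n" "\<forall>l\<le>n. mem s3 ''alv'' l \<le> 1"
          "grouped n near' A (mem s3 ''own'') {l. l \<le> n \<and> mem s3 ''alv'' l \<noteq> 0}"
          using m fa by (simp_all add: merged_def cong: conj_cong)
        show "wp W relabel ?Q s3 \<tau>3"
        proof (rule wp_relabel[OF s3(1-3)])
          fix s4 \<tau>4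
          assume s4: "input r s4"
            and lab4: "\<forall>v<n. mem s4 ''lab'' v =
              (if mem s3 ''alv'' (mem s3 ''own'' v) \<noteq> 0 then mem s3 ''own'' v else 0)"
            and \<tau>4: "\<tau>4 \<le> \<tau>3 + 30 * Suc n"
          have "grouped n near' A (mem s4 ''lab'') (labels n (mem s4 ''lab''))"
            by (rule grouped_normalize[OF s3(4)]) (use lab4 s3(2) in simp)
          then have "has_labels near' A r s4"
            using s4 lab4 s3(2) by (simp add: has_labels_def)
          then show "has_labels near' A r s4 \<and> \<tau>4 \<le> \<tau> + 500 * (Suc n + (\<Sum>v<n. deg v))"
            using s1(5) \<tau>2 \<tau>3 \<tau>4 by simp
        qed
      qed
    qed
  qed
qed

text \<open>The partition into singletons: \<open>a\<close> forms part number \<open>Suc a\<close>,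
  whose set for radius 0 is \<open>{a}\<close>.\<close>

lemma wp_init:
  assumes "input r s" "A \<subseteq> {..<n}" "\<And>v. v < n \<Longrightarrow> mem s ''A'' v = (if v \<in> A then 1 else 0)"
    "\<And>v. mem s ''lab'' v = 0"
    and near: "\<And>a v. a \<in> A \<Longrightarrow> v < n \<Longrightarrow> near a v \<longleftrightarrow> a = v"
    and exit: "\<And>s' \<tau>'. has_labels near A r s' \<Longrightarrow> \<tau>' \<le> \<tau> + 30 * Suc n \<Longrightarrow> Q s' \<tau>'"
  shows "wp W init Q s \<tau>"
proof -
  define J where "J i s' \<longleftrightarrow> input r s' \<and> mem s' ''A'' = mem s ''A'' \<and>
    (\<forall>v. mem s' ''lab'' v = (if v < i \<and> v \<in> A then Suc v else 0))" for i s'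
  show ?thesis
    unfolding init_def
  proof (rule wp_for_loop[where N = n and J = J and c = "\<lambda>_. 15"])
    show "reg s ''n'' = n" using assms(1) by (simp add: input_def)
    show "J 0 (s\<lparr>reg := (reg s)(''i'' := 0)\<rparr>)"
      using assms(1,4) by (simp add: J_def)
  next
    fix i s' \<tau>'
    assume i: "i < n" "reg s' ''i'' = i" "reg s' ''n'' = n" "J i s'"
    show "wp W (If (Less (Const 0) (Read ''A'' (Reg ''i'')))
         (Store ''lab'' (Reg ''i'') (Add (Reg ''i'') (Const 1))) Skip)
       (\<lambda>s'' \<tau>''. reg s'' ''i'' = i \<and> reg s'' ''n'' = n \<and> \<tau>'' \<le> \<tau>' + 15 \<and>
          J (Suc i) (s''\<lparr>reg := (reg s'')(''i'' := Suc i)\<rparr>)) s' \<tau>'"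
      using W i assms(3)[OF i(1)] by (auto simp: J_def less_Suc_eq)
  next
    fix s' \<tau>'
    assume J: "J n s'" and \<tau>': "\<tau>' \<le> \<tau> + 6 + (\<Sum>i<n. 15 + 8)"
    have lab: "mem s' ''lab'' v = (if v \<in> A then Suc v else 0)" if "v < n" for v
      using J that by (simp add: J_def)
    have "Suc ` A = labels n (mem s' ''lab'')"
    proof
      show "Suc ` A \<subseteq> labels n (mem s' ''lab'')"
        using assms(2) lab by (force simp: image_iff)
      show "labels n (mem s' ''lab'') \<subseteq> Suc ` A" using lab by auto
    qed
    moreover have "{v. v < n \<and> mem s' ''lab'' v = l} = {v. v < n \<and> (\<forall>a\<in>A. Suc a = l \<longrightarrow> near a v)}"
      "{v. v < n \<and> mem s' ''lab'' v = l} \<noteq> {}" if "l \<in> Suc ` A" for l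
      using that assms(2) lab near by (auto split: if_splits)
    ultimately have "grouped n near A (mem s' ''lab'') (labels n (mem s' ''lab''))"
      unfolding grouped_def by (intro conjI exI[of _ Suc] ballI) simp_all
    then have "has_labels near A r s'"
      using J lab by (simp add: has_labels_def J_def)
    then show "Q s' \<tau>'" using \<tau>' by (intro exit) auto
  qed (use n_lt_W in auto)
qed

text \<open>The exit condition is the criterion of \<open>grouped_all_near_iff\<close>. The
  invariant keeps witnesses: a nonzero \<open>c\<close> occurs as a label, and a nonzero
  \<open>g\<close> comes with two different nonzero labels.\<close>

lemma wp_detect:
  assumes "input r s" "\<forall>v<n. mem s ''lab'' v \<le> n" "reg s ''c'' = 0" "reg s ''g'' = 0"
    and exit: "\<And>s' \<tau>'. input r s' \<Longrightarrow> mem s' ''lab'' = mem s ''lab'' \<Longrightarrow>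
      reg s' ''c'' \<le> n \<Longrightarrow> reg s' ''g'' \<le> 1 \<Longrightarrow>
      \<forall>v<n. reg s' ''g'' = 0 \<and> mem s ''lab'' v = reg s' ''c'' \<longleftrightarrow>
        labels n (mem s ''lab'') \<subseteq> {mem s ''lab'' v} \<Longrightarrow>
      \<tau>' \<le> \<tau> + 30 * Suc n \<Longrightarrow> Q s' \<tau>'"
  shows "wp W detect Q s \<tau>"
proof -
  define lab where "lab = mem s ''lab''"
  define J where "J i s' \<longleftrightarrow> input r s' \<and> mem s' ''lab'' = lab \<and>
    reg s' ''c'' \<le> n \<and> reg s' ''g'' \<le> 1 \<and>
    (if reg s' ''c'' = 0 then \<forall>v<i. lab v = 0 else \<exists>v<i. lab v = reg s' ''c'') \<and>
    (if reg s' ''g'' = 0 then \<forall>v<i. lab v \<in> {0, reg s' ''c''}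
     else \<exists>v<i. \<exists>w<i. lab v \<noteq> 0 \<and> lab w \<noteq> 0 \<and> lab v \<noteq> lab w)" for i s'
  show ?thesis
    unfolding detect_def
  proof (rule wp_for_loop[where N = n and J = J and c = "\<lambda>_. 20"])
    show "reg s ''n'' = n" using assms(1) by (simp add: input_def)
    show "J 0 (s\<lparr>reg := (reg s)(''i'' := 0)\<rparr>)"
      using assms by (simp add: J_def lab_def)
  next
    fix i s' \<tau>'
    assume i: "i < n" "reg s' ''i'' = i" "reg s' ''n'' = n" "J i s'"
    have "lab i \<le> n" using i(1) assms(2) by (simp add: lab_def)
    then show "wp W (If (Less (Const 0) (Read ''lab'' (Reg ''i'')))
       (If (Eq (Reg ''c'') (Const 0))
         (Assign ''c'' (Read ''lab'' (Reg ''i'')))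
         (If (Eq (Reg ''c'') (Read ''lab'' (Reg ''i''))) Skip (Assign ''g'' (Const 1))))
       Skip)
       (\<lambda>s'' \<tau>''. reg s'' ''i'' = i \<and> reg s'' ''n'' = n \<and> \<tau>'' \<le> \<tau>' + 20 \<and>
          J (Suc i) (s''\<lparr>reg := (reg s'')(''i'' := Suc i)\<rparr>)) s' \<tau>'"
      using W i by (auto simp: J_def less_Suc_eq split: if_splits) metis
  next
    fix s' \<tau>'
    assume J: "J n s'" and \<tau>': "\<tau>' \<le> \<tau> + 6 + (\<Sum>i<n. 20 + 8)"
    have "reg s' ''g'' = 0 \<and> lab v = reg s' ''c'' \<longleftrightarrow> labels n lab \<subseteq> {lab v}" if "v < n" for v
    proof
      assume "reg s' ''g'' = 0 \<and> lab v = reg s' ''c''"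
      then show "labels n lab \<subseteq> {lab v}" using J by (auto simp: J_def)
    next
      assume "labels n lab \<subseteq> {lab v}"
      then have *: "lab w = 0 \<or> lab w = lab v" if "w < n" for w using that by blast
      have g: "reg s' ''g'' = 0"
      proof (rule ccontr)
        assume "reg s' ''g'' \<noteq> 0"
        then obtain w w' where "w < n" "w' < n" "lab w \<noteq> 0" "lab w' \<noteq> 0" "lab w \<noteq> lab w'"
          using J unfolding J_def by auto
        then show False using *[of w] *[of w'] by simp
      qed
      have "lab v = reg s' ''c''"
        using J * g \<open>v < n\<close> by (auto simp: J_def split: if_splits)
      with g show "reg s' ''g'' = 0 \<and> lab v = reg s' ''c''" by simp
    qed
    then show "Q s' \<tau>'" using J \<tau>' by (intro exit) (auto simp: J_def lab_def)
  qed (use n_lt_W in auto)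
qed

lemma wp_emit:
  assumes "input r s" "\<forall>v<n. mem s ''lab'' v \<le> n" "reg s ''c'' \<le> n" "reg s ''g'' \<le> 1"
    and exit: "\<And>s' \<tau>'. \<forall>v<n. mem s' ''out'' v =
        (if reg s ''g'' = 0 \<and> mem s ''lab'' v = reg s ''c'' then 1 else 0) \<Longrightarrow>
      \<tau>' \<le> \<tau> + 30 * Suc n \<Longrightarrow> Q s' \<tau>'"
  shows "wp W emit Q s \<tau>"
proof -
  define lab where "lab = mem s ''lab''"
  define J where "J i s' \<longleftrightarrow> input r s' \<and> mem s' ''lab'' = lab \<and>
    reg s' ''c'' = reg s ''c'' \<and> reg s' ''g'' = reg s ''g'' \<and>
    (\<forall>v<i. mem s' ''out'' v = (if reg s ''g'' = 0 \<and> lab v = reg s ''c'' then 1 else 0))" for i s'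
  show ?thesis
    unfolding emit_def
  proof (rule wp_for_loop[where N = n and J = J and c = "\<lambda>_. 15"])
    show "reg s ''n'' = n" using assms(1) by (simp add: input_def)
    show "J 0 (s\<lparr>reg := (reg s)(''i'' := 0)\<rparr>)"
      using assms by (simp add: J_def lab_def)
  next
    fix i s' \<tau>'
    assume i: "i < n" "reg s' ''i'' = i" "reg s' ''n'' = n" "J i s'"
    have "lab i \<le> n" using i(1) assms(2) by (simp add: lab_def)
    then show "wp W (If (And (Eq (Reg ''g'') (Const 0)) (Eq (Read ''lab'' (Reg ''i'')) (Reg ''c'')))
         (Store ''out'' (Reg ''i'') (Const 1))
         (Store ''out'' (Reg ''i'') (Const 0)))
       (\<lambda>s'' \<tau>''. reg s'' ''i'' = i \<and> reg s'' ''n'' = n \<and> \<tau>'' \<le> \<tau>' + 15 \<and>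
          J (Suc i) (s''\<lparr>reg := (reg s'')(''i'' := Suc i)\<rparr>)) s' \<tau>'"
      using W i assms(3,4) by (auto simp: J_def less_Suc_eq)
  next
    fix s' \<tau>'
    assume "J n s'" "\<tau>' \<le> \<tau> + 6 + (\<Sum>i<n. 15 + 8)"
    then show "Q s' \<tau>'" unfolding J_def lab_def by (intro exit) auto
  qed (use n_lt_W in auto)
qed

text \<open>Each round raises the radius by one, so \<open>has_labels (near i) A i\<close> is
  invariant and the last family belongs to radius \<open>k\<close>.\<close>

lemma wp_small_ecc_prog:
  fixes near :: "nat \<Rightarrow> nat \<Rightarrow> nat \<Rightarrow> bool"
  assumes n: "2 \<le> n" and k: "0 < k"
    and s: "input 0 s" "\<And>v. v < n \<Longrightarrow> mem s ''A'' v = (if v \<in> A then 1 else 0)"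
      "\<And>v. mem s ''lab'' v = 0"
    and A: "A \<subseteq> {..<n}"
    and near_0: "\<And>a v. a \<in> A \<Longrightarrow> v < n \<Longrightarrow> near 0 a v \<longleftrightarrow> a = v"
    and helly: "\<And>i E c u. E \<subseteq> A \<Longrightarrow> c < n \<Longrightarrow> \<forall>a\<in>E. near i a c \<Longrightarrow> u < n \<Longrightarrow>
      \<forall>a\<in>E. near (Suc i) a u \<Longrightarrow> \<exists>w<n. u \<in> nbhd w \<and> (\<forall>a\<in>E. near i a w)"
    and near_Suc: "\<And>i a u w. a \<in> A \<Longrightarrow> w < n \<Longrightarrow> u \<in> nbhd w \<Longrightarrow> near i a w \<Longrightarrow> near (Suc i) a u"
  shows "wp W small_ecc_prog (\<lambda>s' t.
    (\<forall>v<n. mem s' ''out'' v = (if \<forall>a\<in>A. near k a v then 1 else 0)) \<and>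
    t \<le> 1000 * (k * (Suc n + (\<Sum>v<n. deg v)))) s 0"
    (is "wp W _ ?Q s 0")
proof -
  let ?R = "500 * (Suc n + (\<Sum>v<n. deg v))"
  have four: "(4 :: nat) = Suc (Suc (Suc (Suc 0)))" by simp
  have "wp W init (wp W (for_loop ''r'' ''k'' expand_round) (wp W (Assign ''c'' (Const 0))
      (wp W (Assign ''g'' (Const 0)) (wp W detect (wp W emit ?Q))))) s 4"
  proof (rule wp_init[where near = "near 0", OF s(1) A s(2,3) near_0])
    fix s1 \<tau>1
    assume s1: "has_labels (near 0) A 0 s1" and \<tau>1: "\<tau>1 \<le> 4 + 30 * Suc n"
    show "wp W (for_loop ''r'' ''k'' expand_round) (wp W (Assign ''c'' (Const 0))
      (wp W (Assign ''g'' (Const 0)) (wp W detect (wp W emit ?Q)))) s1 \<tau>1"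
    proof (rule wp_for_loop[where N = k and J = "\<lambda>i. has_labels (near i) A i" and c = "\<lambda>_. ?R"])
      show "reg s1 ''k'' = k" using s1 by (simp add: has_labels_def input_def)
      show "has_labels (near 0) A 0 (s1\<lparr>reg := (reg s1)(''r'' := 0)\<rparr>)"
        using s1 by (simp add: has_labels_def input_def)
    next
      fix i s2 \<tau>2
      assume "has_labels (near i) A i s2"
      then have "wp W expand_round (\<lambda>s' \<tau>'. has_labels (near (Suc i)) A i s' \<and> \<tau>' \<le> \<tau>2 + ?R) s2 \<tau>2"
        by (rule wp_expand_round) (erule (4) helly, erule (3) near_Suc)
      then show "wp W expand_round (\<lambda>s' \<tau>'. reg s' ''r'' = i \<and> reg s' ''k'' = k \<and> \<tau>' \<le> \<tau>2 + ?R \<and>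
          has_labels (near (Suc i)) A (Suc i) (s'\<lparr>reg := (reg s')(''r'' := Suc i)\<rparr>)) s2 \<tau>2"
        by (rule wp_mono) (simp add: has_labels_def input_def)
    next
      fix s2 \<tau>2
      assume s2: "has_labels (near k) A k s2" and \<tau>2: "\<tau>2 \<le> \<tau>1 + 6 + (\<Sum>i<k. ?R + 8)"
      let ?s = "s2\<lparr>reg := (reg s2)(''c'' := 0, ''g'' := 0)\<rparr>"
      have lab: "\<forall>v<n. mem s2 ''lab'' v \<le> n" using s2 by (simp add: has_labels_def)
      have "wp W detect (wp W emit ?Q) ?s (\<tau>2 + 4)"
      proof (rule wp_detect[where r = k])
        show "input k ?s" using s2 by (simp add: has_labels_def input_def)
        fix s3 \<tau>3
        assume s3: "input k s3" "mem s3 ''lab'' = mem ?s ''lab''" "reg s3 ''c'' \<le> n" "reg s3 ''g'' \<le> 1"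
          and eq: "\<forall>v<n. reg s3 ''g'' = 0 \<and> mem ?s ''lab'' v = reg s3 ''c'' \<longleftrightarrow>
            labels n (mem ?s ''lab'') \<subseteq> {mem ?s ''lab'' v}"
          and \<tau>3: "\<tau>3 \<le> \<tau>2 + 4 + 30 * Suc n"
        show "wp W emit ?Q s3 \<tau>3"
        proof (rule wp_emit[OF s3(1) _ s3(3,4)])
          show "\<forall>v<n. mem s3 ''lab'' v \<le> n" using lab s3(2) by simp
          fix s4 :: state and \<tau>4 :: nat
          assume out: "\<forall>v<n. mem s4 ''out'' v =
              (if reg s3 ''g'' = 0 \<and> mem s3 ''lab'' v = reg s3 ''c'' then 1 else 0)"
            and \<tau>4: "\<tau>4 \<le> \<tau>3 + 30 * Suc n"
          have g: "grouped n (near k) A (mem s2 ''lab'') (labels n (mem s2 ''lab''))"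
            using s2 by (simp add: has_labels_def)
          have "mem s4 ''out'' v = (if \<forall>a\<in>A. near k a v then 1 else 0)" if "v < n" for v
            using grouped_all_near_iff[OF g that] eq out s3(2) that by simp
          moreover have "\<tau>4 \<le> 1000 * (k * (Suc n + (\<Sum>v<n. deg v)))"
          proof -
            \<comment> \<open>As \<open>k\<close> is positive, the cost outside the rounds, at most
              \<open>200 * N\<close>, and the loop overhead \<open>8 * k\<close> are both absorbed
              into multiples of \<open>k * N\<close>.\<close>
            define N where "N = Suc n + (\<Sum>v<n. deg v)"
            have "\<tau>4 \<le> 14 + 90 * Suc n + k * (500 * N + 8)"
              using \<tau>1 \<tau>2 \<tau>3 \<tau>4 by (simp add: N_def)
            moreover have "14 + 90 * Suc n \<le> 200 * N" using n by (simp add: N_def)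
            moreover have "N \<le> k * N" using mult_le_mono1[of 1 k N] k by simp
            moreover have "k \<le> k * N" using mult_le_mono2[of 1 N k] by (simp add: N_def)
            moreover have "k * (500 * N + 8) = 500 * (k * N) + 8 * k" by (simp add: algebra_simps)
            ultimately show ?thesis unfolding N_def[symmetric] by linarith
          qed
          ultimately show "?Q s4 \<tau>4" by blast
        qed
      qed (use lab in simp_all)
      then show "wp W (Assign ''c'' (Const 0))
          (wp W (Assign ''g'' (Const 0)) (wp W detect (wp W emit ?Q))) s2 \<tau>2"
        using W by (simp add: numeral_eq_Suc)
    qed (use W in auto)
  qed
  then show ?thesis
    unfolding small_ecc_prog_def wp_If wp_Seq using n input_n[OF s(1)] W
    by (simp add: four split del: if_split)
qed

end

section \<open>From adjacency lists to Helly graphs\<close>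

lemma adj_lists_sum_length_le:
  assumes "pair_graph G" "adj_lists G vs ns"
  shows "(\<Sum>v<length vs. length (ns ! v)) \<le> card (parcs G)"
proof -
  interpret pair_graph G by fact
  \<comment> \<open>List entries correspond to pairs of vertex numbers, which inject into the arcs
    because the numbering \<open>vs\<close> is injective.\<close>
  let ?S = "SIGMA v:{..<length vs}. set (ns ! v)"
  have vs: "distinct vs" and ns: "\<And>v. v < length vs \<Longrightarrow> distinct (ns ! v) \<and>
      set (ns ! v) = {j. j < length vs \<and> (vs ! v, vs ! j) \<in> parcs G}"
    using assms(2) by (auto simp: adj_lists_def)
  have "(\<Sum>v<length vs. length (ns ! v)) = (\<Sum>v<length vs. card (set (ns ! v)))"
    by (rule sum.cong) (use ns distinct_card in fastforce)+
  also have "\<dots> = card ?S" by (simp add: card_SigmaI)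
  also have "\<dots> \<le> card (parcs G)"
  proof (rule card_inj_on_le[OF _ _ pair_finite_arcs])
    show "inj_on (\<lambda>(v, j). (vs ! v, vs ! j)) ?S"
      using vs ns by (auto simp: inj_on_def nth_eq_iff_index_eq)
    show "(\<lambda>(v, j). (vs ! v, vs ! j)) ` ?S \<subseteq> parcs G" using ns by auto
  qed
  finally show ?thesis .
qed

theorem theorem2:
  shows "\<exists>(P :: com) (C :: nat) (d :: nat).
    \<forall>(G :: 'a pair_pre_digraph) (A :: 'a set) (k :: nat) (vs :: 'a list) (ns :: nat list list)
       (n :: nat) (m :: nat).
      helly_graph G \<longrightarrow> n = card (pverts G) \<longrightarrow> m = card (edges G) \<longrightarrow>
      A \<subseteq> pverts G \<longrightarrow> 0 < k \<longrightarrow> adj_lists G vs ns \<longrightarrow>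
      (\<exists>t s. exec ((n + k + 2) ^ d) P (input_state vs ns A k) t s \<and>
             t \<le> C * max 1 (k * m) \<and>
             outputs_set vs s (small_ecc G A k))"
\<comment> \<open>The constant 6000 is 1000 from the program bound times 6 from comparing vertices
  and degrees with \<open>m\<close>. The exponent 2 is chosen since offsets can be quadratic in
  \<open>n\<close>.\<close>
proof (rule exI[of _ small_ecc_prog], rule exI[of _ 6000], rule exI[of _ 2], intro allI impI)
  fix G :: "'a pair_pre_digraph" and A :: "'a set" and k :: nat and vs :: "'a list"
    and ns :: "nat list list" and n m :: nat
  assume helly: "helly_graph G" and n: "n = card (pverts G)" and m: "m = card (edges G)"
    and A: "A \<subseteq> pverts G" and k: "0 < k" and adj: "adj_lists G vs ns"
  let ?W = "(n + k + 2) ^ 2" and ?s = "input_state vs ns A k"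
  interpret pair_graph G using helly by (simp add: helly_graph_def)
  have conn: "Digraph_Component.connected (with_proj G)" using helly by (simp add: helly_graph_def)
  have vs: "distinct vs" "set vs = pverts G" and len_ns: "length ns = length vs"
    and ns: "\<And>v. v < length vs \<Longrightarrow> distinct (ns ! v) \<and>
      set (ns ! v) = {j. j < length vs \<and> (vs ! v, vs ! j) \<in> parcs G}"
    using adj by (auto simp: adj_lists_def)
  have len: "length vs = n" using vs n by (metis distinct_card)
  have vs_nth: "vs ! v \<in> pverts G" if "v < n" for v using that vs(2) len by (metis nth_mem)
  \<comment> \<open>The problem asks for \<open>A\<close> inside the ball around \<open>b\<close>,
    whereas the algorithm tracks \<open>b\<close> inside the balls around \<open>A\<close>.\<close>
  have commute: "vs ! v \<in> small_ecc G A k \<longleftrightarrow> (\<forall>a\<in>A. vs ! v \<in> nball G k a)" if "v < n" for v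
    using vs_nth[OF that] mem_nball_commute by (auto simp: small_ecc_def)
  have "\<exists>t s. exec ?W small_ecc_prog ?s t s \<and> outputs_set vs s (small_ecc G A k) \<and>
      t \<le> 6000 * max 1 (k * m)"
  proof (cases "n < 2")
    case True
    \<comment> \<open>Connectedness excludes the empty graph. In the one-vertex graph the only
      vertex is always in the output.\<close>
    have "pverts G \<noteq> {}" using conn by (auto simp: connected_conv)
    then have n1: "n = 1" using True n pair_finite_verts by (simp add: card_eq_0_iff less_2_cases_iff)
    then have verts: "pverts G = {vs ! 0}" using vs(2) len by (cases vs) auto
    have "vs ! 0 \<in> nball G k (vs ! 0)"
      by (rule mem_nballI[of _ "[]"]) (simp_all add: awalk_Nil_iff verts)
    then have "vs ! 0 \<in> small_ecc G A k" using commute[of 0] n1 A verts by auto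
    then have "wp ?W small_ecc_prog (\<lambda>s t. outputs_set vs s (small_ecc G A k) \<and> t \<le> 10) ?s 0"
      using len n1 unfolding small_ecc_prog_def
      by (simp add: input_state_def outputs_set_def power2_eq_square)
    then obtain t s where "exec ?W small_ecc_prog ?s t s" "outputs_set vs s (small_ecc G A k)" "t \<le> 10"
      unfolding wp_def by auto
    moreover from this(3) have "t \<le> 6000 * max 1 (k * m)"
      using max.cobounded1[of 1 "k * m"] by linarith
    ultimately show ?thesis by blast
  next
    case False
    define near where "near i a v \<longleftrightarrow> vs ! v \<in> nball G i (vs ! a)" for i a v
    let ?A = "{v. v < n \<and> vs ! v \<in> A}"
    interpret adjacency n k ns ?W
    proof
      show "length ns = n" using len_ns len by simp
      show "distinct (ns ! v) \<and> set (ns ! v) \<subseteq> {..<n}" if "v < n" for v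
        using ns[of v] len that by auto
      show "n * n + n + k + 3 < ?W" using k by (simp add: power2_eq_square algebra_simps)
    qed
    \<comment> \<open>Adjacency lists give arcs leaving \<open>w\<close>, the ball recursion needs
      arcs entering \<open>w\<close>; symmetry of the arcs reconciles the two.\<close>
    have nbhd: "u \<in> nbhd w \<longleftrightarrow> vs ! u = vs ! w \<or> (vs ! u, vs ! w) \<in> parcs G" if "w < n" "u < n" for u w
      using ns[of w] that len vs(1) arcs_symmetric by (auto simp: nbhd_def nth_eq_iff_index_eq)
    have img: "A = (!) vs ` ?A"
    proof
      show "A \<subseteq> (!) vs ` ?A"
      proof
        fix a assume "a \<in> A"
        then obtain v where "v < n" "vs ! v = a" using A vs(2) len by (metis in_set_conv_nth subsetD)
        then show "a \<in> (!) vs ` ?A" using \<open>a \<in> A\<close> by blast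
      qed
    qed auto
    have "wp ?W small_ecc_prog (\<lambda>s' t.
        (\<forall>v<n. mem s' ''out'' v = (if \<forall>a\<in>?A. near k a v then 1 else 0)) \<and>
        t \<le> 1000 * (k * (Suc n + (\<Sum>v<n. deg v)))) ?s 0"
    proof (rule wp_small_ecc_prog[OF _ k])
      show "input 0 ?s"
        using len by (simp add: input_def input_state_def off_def adj_def fun_eq_iff)
      show "mem ?s ''A'' v = (if v \<in> ?A then 1 else 0)" if "v < n" for v
        using len that by (simp add: input_state_def)
      show "mem ?s ''lab'' v = 0" for v by (simp add: input_state_def)
      show "near 0 a v \<longleftrightarrow> a = v" if "a \<in> ?A" "v < n" for a v
        using that vs(1) len vs_nth by (auto simp: near_def nball_0 nth_eq_iff_index_eq)
      show "near (Suc i) a u" if "a \<in> ?A" "w < n" "u \<in> nbhd w" "near i a w" for i a u w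
        using that nbhd[of w u] nbhd_subset[of w] unfolding near_def mem_nball_Suc by blast
    next
      fix i E c u
      assume E: "E \<subseteq> ?A" and c: "c < n" "\<forall>a\<in>E. near i a c" and u: "u < n" "\<forall>a\<in>E. near (Suc i) a u"
      obtain x where x: "x \<in> pverts G" "vs ! u = x \<or> (vs ! u, x) \<in> parcs G"
        "\<And>a. a \<in> (!) vs ` E \<Longrightarrow> x \<in> nball G i a"
        by (rule helly_expand_common_ball[OF helly, where A = "(!) vs ` E" and b = "vs ! u" and c = "vs ! c" and i = i])
          (use E c u vs_nth in \<open>auto simp: near_def\<close>)
      obtain w where "w < n" "vs ! w = x" using x(1) vs(2) len by (metis in_set_conv_nth)
      then show "\<exists>w<n. u \<in> nbhd w \<and> (\<forall>a\<in>E. near i a w)"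
        using x(2,3) nbhd[of w u] u(1) unfolding near_def by blast
    qed (use False in auto)
    then obtain t s where "exec ?W small_ecc_prog ?s t s"
      and out: "\<forall>v<n. mem s ''out'' v = (if \<forall>a\<in>?A. near k a v then 1 else 0)"
      and t: "t \<le> 1000 * (k * (Suc n + (\<Sum>v<n. deg v)))"
      unfolding wp_def by auto
    moreover have "(\<forall>a\<in>?A. near k a v) \<longleftrightarrow> vs ! v \<in> small_ecc G A k" if "v < n" for v
      unfolding commute[OF that] near_def by (subst img) blast
    then have "outputs_set vs s (small_ecc G A k)"
      using out len by (simp add: outputs_set_def)
    moreover have "t \<le> 6000 * max 1 (k * m)"
    proof -
      have "n \<le> card (parcs G)" using connected_card_verts_le_arcs[OF conn] False n by simp
      moreover have "(\<Sum>v<n. deg v) \<le> card (parcs G)"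
        using adj_lists_sum_length_le[OF pair_graph_axioms adj] len by (simp add: deg_def)
      \<comment> \<open>Both \<open>n\<close> and the degree sum are at most the number of arcs,
        hence at most \<open>2 * m\<close>; the remaining 1 is covered since \<open>m\<close> is
        positive for \<open>n\<close> at least 2.\<close>
      ultimately have "Suc n + (\<Sum>v<n. deg v) \<le> 6 * m"
        using card_arcs_le_edges m False by simp
      then have "k * (Suc n + (\<Sum>v<n. deg v)) \<le> k * (6 * m)" by (rule mult_le_mono2)
      also have "\<dots> \<le> 6 * max 1 (k * m)" by simp
      finally show ?thesis using t by linarith
    qed
    ultimately show ?thesis by blast
  qed
  then show "\<exists>t s. exec ?W small_ecc_prog ?s t s \<and> t \<le> 6000 * max 1 (k * m) \<and>
      outputs_set vs s (small_ecc G A k)" by blast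
qed

end
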